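(* Let $c\in\mathbb{C}$ and let $n\geq 1$ be an integer. Let $f(z)$ be a nonconstant entire function of finite order such that $\Delta_c^n f(z)\not\equiv 0$, and let $a(z), b(z)\in S(f)$ with $b(z)\not\equiv 0$ be periodic entire functions with period $c$. If $f(z)-a(z)$, $\Delta_c^n f(z)-b(z)$ and $\Delta_c^{n+1} f(z)-b(z)$ share $0$ CM, then $$\Delta_c f(z)\equiv f(z)+b(z)-a(z).$$
   Context: Difference operators: for a meromorphic function $f$ in $\mathbb{C}$, $\Delta_c f(z)=f(z+c)-f(z)$ and $\Delta_c^n f(z)=\Delta_c^{n-1}(\Delta_c f(z))$ for $n\geq 2$. Let $T(r,f)$ be the Nevanlinna characteristic of $f$; finite order means $\rho(f)=\limsup_{r\to\infty}\frac{\log^+ T(r,f)}{\log r}<\infty$. $S(r,f)$ denotes any quantity that is $o(T(r,f))$ as $r\to\infty$ outside a possible exceptional set of finite logarithmic measure; a meromorphic function $\varphi$ is a small function of $f$ if $T(r,\varphi)=S(r,f)$, and $S(f)$ is the family of all small functions of $f$. Periodic with period $c$ means $a(z+c)\equiv a(z)$. Functions share $0$ CM if they all have the same zeros, counting multiplicities. *)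

theory Defs
  imports "HOL-Complex_Analysis.Complex_Analysis" "HOL-Library.Landau_Symbols"
begin

definition fwd_diff :: "complex \<Rightarrow> (complex \<Rightarrow> complex) \<Rightarrow> complex \<Rightarrow> complex" where
  "fwd_diff c f = (\<lambda>z. f (z + c) - f z)"

definition log_plus :: "real \<Rightarrow> real" where
  "log_plus x = ln (max 1 x)"

definition proximity :: "real \<Rightarrow> (complex \<Rightarrow> complex) \<Rightarrow> real" where
  "proximity r f =
     1 / (2 * pi) * integral {0..2 * pi} (\<lambda>t. log_plus (cmod (f (of_real r * cis t))))"

(* Poles in the closed disc of radius t, counted with multiplicity.  At a pole the
   library's zorder is the negative of the pole order. *)
definition pole_count :: "real \<Rightarrow> (complex \<Rightarrow> complex) \<Rightarrow> nat" where
  "pole_count t f = (\<Sum>z | cmod z \<le> t \<and> is_pole f z. nat (- zorder f z))"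

definition pole_counting :: "real \<Rightarrow> (complex \<Rightarrow> complex) \<Rightarrow> real" where
  "pole_counting r f =
     integral {0..r} (\<lambda>t. (real (pole_count t f) - real (pole_count 0 f)) / t)
       + real (pole_count 0 f) * ln r"

definition nevanlinna_T :: "real \<Rightarrow> (complex \<Rightarrow> complex) \<Rightarrow> real" where
  "nevanlinna_T r f = proximity r f + pole_counting r f"

definition growth_order :: "(complex \<Rightarrow> complex) \<Rightarrow> ereal" where
  "growth_order f = Limsup at_top (\<lambda>r. ereal (log_plus (nevanlinna_T r f) / ln r))"

definition finite_order :: "(complex \<Rightarrow> complex) \<Rightarrow> bool" where
  "finite_order f \<longleftrightarrow> growth_order f < \<infinity>"

(* Restricting to [1, infinity) discards the neighbourhood of 0, which is irrelevant
   for r tending to infinity but would contribute to the integral of dr/r. *)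
definition finite_log_measure :: "real set \<Rightarrow> bool" where
  "finite_log_measure E \<longleftrightarrow> E \<in> sets lebesgue \<and> E \<subseteq> {1..} \<and>
     (\<integral>\<^sup>+ r \<in> E. ennreal (1 / r) \<partial>lebesgue) < \<infinity>"

(* "q is S(r,f)": q(r) = o(T(r,f)) as r tends to infinity outside E. *)
definition is_S :: "(complex \<Rightarrow> complex) \<Rightarrow> (real \<Rightarrow> real) \<Rightarrow> bool" where
  "is_S f q \<longleftrightarrow> (\<exists>E. finite_log_measure E \<and>
     q \<in> o[inf at_top (principal (- E))](\<lambda>r. nevanlinna_T r f))"

definition small_functions :: "(complex \<Rightarrow> complex) \<Rightarrow> (complex \<Rightarrow> complex) set" where
  "small_functions f = {\<phi>. \<phi> meromorphic_on UNIV \<and> is_S f (\<lambda>r. nevanlinna_T r \<phi>)}"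

definition periodic_with :: "complex \<Rightarrow> (complex \<Rightarrow> complex) \<Rightarrow> bool" where
  "periodic_with c a \<longleftrightarrow> (\<forall>z. a (z + c) = a z)"

(* For families of entire functions.  At a zero of an entire function that is not
   identically zero, zorder is its multiplicity.  An identically vanishing member
   forces all members to vanish identically, by equality of the zero sets. *)
definition share_zero_CM :: "(complex \<Rightarrow> complex) set \<Rightarrow> bool" where
  "share_zero_CM F \<longleftrightarrow> (\<forall>g\<in>F. \<forall>h\<in>F. \<forall>z.
     (g z = 0 \<longleftrightarrow> h z = 0) \<and> (g z = 0 \<longrightarrow> zorder g z = zorder h z))"

end

theory Submission
  imports Defs
begin

text \<open>
Write \<open>F = f - a\<close>. Sharing zeros gives \<open>\<Delta>\<^sup>n F = e\<^sup>p F + b\<close> and \<open>\<Delta>\<^bsup>n+1\<^esup> F = e\<^sup>q F + b\<close>, and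
finite order forces \<open>p\<close> and \<open>q\<close> to be polynomials. Applying \<open>\<Delta>\<close> to the first equation, \<open>y = e\<^sup>p F\<close>
solves the first-order equation \<open>y(z + c) = (1 + R) y + b\<close> with \<open>R = e\<^bsup>q-p\<^esup>\<close>, so the first equation
becomes a linear equation for \<open>y\<close> alone and \<open>y / b\<close> is a quotient of exponential sums. If
\<open>d = max (deg p) (deg q) > 0\<close>, exponential sums are graded by their frequencies \<open>\<kappa>\<close> in \<open>e\<^bsup>\<kappa> z^d\<^esup>\<close> over
the coefficients of growth \<open>exp O(\<bar>z\<bar>\<^bsup>d-1\<^esup>)\<close>; by Borel's theorem the grading is well defined, and it is
invariant under shifts. Comparing the degrees of \<open>y\<close> in two opposite directions of the frequency plane
contradicts the two equations unless \<open>q - p\<close> has degree below \<open>d\<close>. In that case the grading gives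
\<open>R = 1\<close>, so that \<open>y + b\<close> doubles under the shift, and then \<open>\<Delta>\<^sup>n e\<^bsup>-p\<^esup>\<close> doubles as well, which is again
impossible. Hence \<open>p\<close> and \<open>q\<close> are constant, and an elementary computation gives
\<open>e\<^sup>p = e\<^sup>q = 1\<close>.
\<close>

section \<open>Jensen's inequality and the Nevanlinna characteristic\<close>

lemma continuous_antiderivative:
  fixes \<psi> :: "real \<Rightarrow> real"
  assumes "continuous_on UNIV \<psi>"
  obtains A where "\<And>x. (A has_real_derivative \<psi> x) (at x)"
proof -
  have "\<exists>F. \<forall>x. -\<infinity> < ereal x \<longrightarrow> ereal x < \<infinity> \<longrightarrow> (F has_vector_derivative \<psi> x) (at x)"
    using assms by (intro einterval_antiderivative) (auto simp: continuous_on_eq_continuous_at)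
  then show ?thesis
    using that by (auto simp: has_real_derivative_iff_has_vector_derivative)
qed

lemma integral_antiderivative:
  fixes A \<psi> :: "real \<Rightarrow> real"
  assumes "\<And>x. (A has_real_derivative \<psi> x) (at x)" "a \<le> b"
  shows "integral {a..b} \<psi> = A b - A a"
  using assms
  by (intro integral_unique fundamental_theorem_of_calculus)
     (auto simp: has_real_derivative_iff_has_vector_derivative[symmetric] intro: has_field_derivative_at_within)

lemma antiderivative_period:
  fixes A \<psi> :: "real \<Rightarrow> real"
  assumes A: "\<And>x. (A has_real_derivative \<psi> x) (at x)" and per: "\<And>x. \<psi> (x + 2 * pi) = \<psi> x"
  shows "A (x + 2 * pi) - A x = integral {0..2*pi} \<psi>"
proof -
  have "((\<lambda>x. A (x + 2 * pi) - A x) has_real_derivative 0) (at x)" for x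
    using DERIV_diff[OF DERIV_shift[THEN iffD1, OF A[of "x + 2*pi"]] A[of x]] by (simp add: per)
  then have "A (x + 2 * pi) - A x = A (0 + 2 * pi) - A 0"
    using DERIV_isconst_all by blast
  then show ?thesis using integral_antiderivative[OF A, of 0 "2*pi"] by simp
qed

text \<open>On each cell the mean value theorem for the antiderivative and uniform continuity
  compare a summand with the integral over its own cell, and the cells tile one period wherever
  \<tau> lies. So one \<open>N\<close> serves every starting point on the circle, as the maximum
  principle requires.\<close>

lemma periodic_Riemann_sum_le:
  fixes \<psi> :: "real \<Rightarrow> real"
  assumes cont: "continuous_on UNIV \<psi>" and per: "\<And>x. \<psi> (x + 2 * pi) = \<psi> x" and "\<epsilon> > 0"
  obtains N :: nat where "N > 0"
    "\<And>\<tau>. 0 \<le> \<tau> \<Longrightarrow> \<tau> \<le> 2*pi \<Longrightarrow>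
        (\<Sum>j<N. \<psi> (\<tau> + 2 * pi * j / N)) / N \<le> 1 / (2*pi) * integral {0..2*pi} \<psi> + \<epsilon>"
proof -
  obtain A where A: "\<And>x. (A has_real_derivative \<psi> x) (at x)"
    using continuous_antiderivative[OF cont] by blast
  \<comment> \<open>The sample points start at \<tau> \<le> 2 pi and run through one further period,
    so they stay below 4 pi.\<close>
  have "uniformly_continuous_on {0..4*pi} \<psi>"
    using cont continuous_on_subset by (intro compact_uniformly_continuous) auto
  then obtain \<delta> where \<delta>: "\<delta> > 0" "\<And>x y. x \<in> {0..4*pi} \<Longrightarrow> y \<in> {0..4*pi} \<Longrightarrow> \<bar>y - x\<bar> < \<delta> \<Longrightarrow> \<bar>\<psi> y - \<psi> x\<bar> < \<epsilon>"
    unfolding uniformly_continuous_on_def dist_real_def using \<open>\<epsilon> > 0\<close> by metis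
  obtain N :: nat where N: "2 * pi / \<delta> < N" using reals_Archimedean2 by blast
  then have Npos: "N > 0" using \<delta> pi_gt_zero by (cases N) (auto simp: field_simps)
  have h: "2 * pi / N < \<delta>" using N \<delta> Npos by (simp add: field_simps)
  have hpos: "2 * pi / N > 0" using Npos by simp
  show ?thesis
  proof (rule that[OF Npos])
    fix \<tau> :: real assume \<tau>: "0 \<le> \<tau>" "\<tau> \<le> 2*pi"
    define t where "t j = \<tau> + 2 * pi * real j / N" for j :: nat
    have tS: "t (Suc j) = t j + 2 * pi / N" for j
      by (simp add: t_def add_divide_distrib algebra_simps)
    have piece: "\<psi> (t j) * (2*pi/N) \<le> A (t (Suc j)) - A (t j) + \<epsilon> * (2*pi/N)" if "j < N" for j
    proof -
      have lt: "t j < t (Suc j)" using tS hpos by simp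
      obtain z where z: "z > t j" "z < t (Suc j)" "A (t (Suc j)) - A (t j) = (t (Suc j) - t j) * \<psi> z"
        using MVT2[OF lt, of A \<psi>] A by blast
      have "real (Suc j) \<le> real N" using that by simp
      then have "2 * pi * real (Suc j) \<le> 2 * pi * real N"
        by (intro mult_left_mono) auto
      then have "2 * pi * real (Suc j) / N \<le> 2 * pi"
        using Npos by (simp add: divide_le_eq)
      then have "t (Suc j) \<le> 4*pi" using \<tau> by (simp add: t_def)
      moreover have "0 \<le> t j" using \<tau> by (simp add: t_def)
      ultimately have "\<bar>\<psi> (t j) - \<psi> z\<bar> < \<epsilon>"
        using z tS[of j] h by (intro \<delta>) auto
      then have "\<psi> (t j) * (2*pi/N) \<le> (\<psi> z + \<epsilon>) * (2*pi/N)"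
        using hpos by (intro mult_right_mono) auto
      then show ?thesis using z(3) tS[of j] by (simp add: distrib_right mult.commute add_divide_distrib)
    qed
    have "(\<Sum>j<N. \<psi> (t j)) * (2*pi/N) \<le> (\<Sum>j<N. A (t (Suc j)) - A (t j) + \<epsilon> * (2*pi/N))"
      unfolding sum_distrib_right using piece by (intro sum_mono) auto
    also have "\<dots> = A (t N) - A (t 0) + \<epsilon> * (2*pi)"
      using Npos by (simp add: sum.distrib sum_lessThan_telescope[where f = "\<lambda>j. A (t j)"])
    also have "t N = \<tau> + 2*pi" using Npos by (simp add: t_def)
    also have "t 0 = \<tau>" by (simp add: t_def)
    also have "A (\<tau> + 2*pi) - A \<tau> = integral {0..2*pi} \<psi>"
      by (rule antiderivative_period[OF A per])
    finally show "(\<Sum>j<N. \<psi> (\<tau> + 2 * pi * j / N)) / N \<le> 1 / (2*pi) * integral {0..2*pi} \<psi> + \<epsilon>"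
      by (simp add: t_def field_simps)
  qed
qed

text \<open>The product of \<open>V\<close> over \<open>N\<close> equidistributed rotations of its argument has the value
  \<open>(V 0) ^ N\<close> at the origin, so the maximum principle bounds \<open>ln \<bar>V 0\<bar>\<close> by a Riemann sum
  of \<open>\<psi>\<close>. Zeros of \<open>V\<close> cause no difficulty in this argument.\<close>

lemma norm_le_exp_circle_mean:
  fixes V :: "complex \<Rightarrow> complex" and \<psi> :: "real \<Rightarrow> real"
  assumes "R > 0" and contV: "continuous_on (cball 0 R) V" and holV: "V holomorphic_on ball 0 R"
    and cont: "continuous_on UNIV \<psi>" and per: "\<And>x. \<psi> (x + 2 * pi) = \<psi> x"
    and le: "\<And>t. cmod (V (of_real R * cis t)) \<le> exp (\<psi> t)"
  shows "cmod (V 0) \<le> exp (1 / (2*pi) * integral {0..2*pi} \<psi>)"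
proof -
  define m where "m = 1 / (2*pi) * integral {0..2*pi} \<psi>"
  have *: "cmod (V 0) \<le> exp (m + \<epsilon>)" if "\<epsilon> > 0" for \<epsilon>
  proof -
    obtain N :: nat where N: "N > 0"
      "\<And>\<tau>. 0 \<le> \<tau> \<Longrightarrow> \<tau> \<le> 2*pi \<Longrightarrow> (\<Sum>j<N. \<psi> (\<tau> + 2 * pi * j / N)) / N \<le> m + \<epsilon>"
      using periodic_Riemann_sum_le[OF cont per \<open>\<epsilon> > 0\<close>] unfolding m_def by blast
    define P where "P z = (\<Prod>j<N. V (z * cis (2 * pi * real j / N)))" for z
    have "norm (P 0) \<le> exp (N * (m + \<epsilon>))"
    proof (rule maximum_modulus_frontier[where S = "ball 0 R" and f = P and \<xi> = 0])
      have maps: "(\<lambda>z. z * cis u) ` ball 0 R \<subseteq> ball 0 R"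
        "(\<lambda>z. z * cis u) ` cball 0 R \<subseteq> cball 0 R" for u
        by (auto simp: norm_mult)
      have "(\<lambda>z. V (z * cis u)) holomorphic_on ball 0 R" for u
        by (rule holomorphic_on_compose_gen[OF _ holV maps(1)[of u], unfolded o_def])
           (auto intro!: holomorphic_intros)
      then show "P holomorphic_on interior (ball 0 R)"
        unfolding P_def by (auto intro!: holomorphic_on_prod)
      have "continuous_on (cball 0 R) (\<lambda>z. V (z * cis u))" for u
        using maps(2)[of u] by (intro continuous_on_compose2[OF contV] continuous_intros) auto
      then show "continuous_on (closure (ball 0 R)) P"
        unfolding P_def using \<open>R > 0\<close> by (auto intro!: continuous_on_prod)
      show "bounded (ball (0::complex) R)" "0 \<in> ball (0::complex) R" using \<open>R > 0\<close> by auto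
      fix z :: complex assume "z \<in> frontier (ball 0 R)"
      then have "cmod z = R" using \<open>R > 0\<close> by auto
      define \<tau> where "\<tau> = Arg2pi z"
      have z: "z = of_real R * cis \<tau>"
        using Arg2pi_eq[of z] \<open>cmod z = R\<close> by (simp add: \<tau>_def cis_conv_exp)
      have \<tau>: "0 \<le> \<tau>" "\<tau> \<le> 2*pi"
        using Arg2pi[of z] by (auto simp: \<tau>_def)
      have "norm (P z) \<le> (\<Prod>j<N. exp (\<psi> (\<tau> + 2 * pi * j / N)))"
        unfolding P_def prod_norm[symmetric] z
        using le by (intro prod_mono) (auto simp: mult.assoc cis_mult)
      also have "\<dots> = exp (\<Sum>j<N. \<psi> (\<tau> + 2 * pi * j / N))" by (simp add: exp_sum)
      also have "\<dots> \<le> exp (N * (m + \<epsilon>))"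
        using N(2)[OF \<tau>] N(1) by (simp add: field_simps)
      finally show "norm (P z) \<le> exp (N * (m + \<epsilon>))" .
    qed
    then have "cmod (V 0) ^ N \<le> exp (m + \<epsilon>) ^ N"
      by (simp add: P_def norm_power exp_of_nat_mult)
    then show ?thesis
      using N(1) power_mono_iff[of "cmod (V 0)" "exp (m+\<epsilon>)" N] by simp
  qed
  have "((\<lambda>\<epsilon>. exp (m + \<epsilon>)) \<longlongrightarrow> exp (m + 0)) (at_right 0)"
    by (intro tendsto_intros)
  then have "cmod (V 0) \<le> exp (m + 0)"
    by (rule tendsto_lowerbound) (auto simp: * eventually_at_filter)
  then show ?thesis by (simp add: m_def)
qed

section \<open>Pointwise bounds from the proximity function\<close>

lemma continuous_on_circle_log_plus:
  assumes "f holomorphic_on UNIV"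
  shows "continuous_on UNIV (\<lambda>t. log_plus (cmod (f (z0 + of_real R * cis t))))"
proof -
  have "continuous_on UNIV f" using assms holomorphic_on_imp_continuous_on by blast
  then have "continuous_on UNIV (\<lambda>t. f (z0 + of_real R * cis t))"
    by (rule continuous_on_compose2) (auto simp: cis_conv_exp intro!: continuous_intros)
  then show ?thesis unfolding log_plus_def
    by (intro continuous_intros) auto
qed

lemma log_plus_nonneg: "log_plus x \<ge> 0"
  by (simp add: log_plus_def)

lemma proximity_nonneg: "proximity r f \<ge> 0"
proof -
  \<comment> \<open>For arbitrary \<open>f\<close> the integrand may fail to be integrable; the
    integral then has the default value 0.\<close>
  have "integral {0..2*pi} (\<lambda>t. log_plus (cmod (f (of_real r * cis t)))) \<ge> 0"
    by (cases "(\<lambda>t. log_plus (cmod (f (of_real r * cis t)))) integrable_on {0..2*pi}")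
       (auto intro!: integral_nonneg simp: log_plus_nonneg not_integrable_integral)
  then show ?thesis by (simp add: proximity_def)
qed

lemma exp_log_plus_ge: "x \<le> exp (log_plus x)"
  by (simp add: log_plus_def)

text \<open>The real part is the Poisson kernel (1 - |\<beta>|^2) / |1 + \<beta>|^2, hence at least
  (1 - |\<beta>|) / (1 + |\<beta>|), which is 1/3 at |\<beta>| = 1/2. Its reciprocal is the factor 3
  in \<open>log_plus_le_proximity\<close>.\<close>

lemma Re_Moebius_quotient_ge:
  assumes "cmod \<beta> \<le> 1/2"
  shows "Re ((1 - \<beta>) / (1 + \<beta>)) \<ge> 1/3"
proof -
  have nz: "1 + \<beta> \<noteq> 0"
  proof
    assume "1 + \<beta> = 0" then have "\<beta> = -1" by (simp add: add_eq_0_iff)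
    then show False using assms by simp
  qed
  have "(1 - \<beta>) / (1 + \<beta>) = ((1 - \<beta>) * cnj (1 + \<beta>)) / of_real ((cmod (1+\<beta>))\<^sup>2)"
    using complex_div_cnj[of "1 - \<beta>" "1 + \<beta>"] by simp
  then have "Re ((1 - \<beta>) / (1 + \<beta>)) = Re ((1 - \<beta>) * cnj (1 + \<beta>)) / (cmod (1+\<beta>))\<^sup>2"
    by (metis Re_divide_of_real)
  also have "Re ((1 - \<beta>) * cnj (1 + \<beta>)) = 1 - (cmod \<beta>)\<^sup>2"
    by (simp add: cmod_power2) (simp add: algebra_simps power2_eq_square)
  finally have eq: "Re ((1 - \<beta>) / (1 + \<beta>)) = (1 - (cmod \<beta>)\<^sup>2) / (cmod (1+\<beta>))\<^sup>2" .
  have le: "(cmod (1+\<beta>))\<^sup>2 \<le> (1 + cmod \<beta>)\<^sup>2"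
    using norm_triangle_ineq[of 1 \<beta>] by (intro power_mono) auto
  have "(1 + cmod \<beta>)\<^sup>2 \<le> 3 * (1 - (cmod \<beta>)\<^sup>2)"
  proof -
    have "(1 + cmod \<beta>) * (1 + cmod \<beta>) \<le> (3 * (1 - cmod \<beta>)) * (1 + cmod \<beta>)"
      using assms by (intro mult_right_mono) auto
    then show ?thesis by (simp add: power2_eq_square algebra_simps)
  qed
  with le have "(cmod (1+\<beta>))\<^sup>2 \<le> 3 * (1 - (cmod \<beta>)\<^sup>2)" by linarith
  then show ?thesis unfolding eq using nz by (simp add: field_simps)
qed

text \<open>A Moebius transformation carries the origin to \<open>w\<close>; on the boundary circle it is the
  change of angle \<open>s t = t + 2 Arg (1 + \<alpha> e\<^bsup>-it\<^esup>)\<close>, whose derivative is a Poisson kernel.\<close>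

lemma log_plus_le_proximity:
  assumes hol: "f holomorphic_on UNIV" and R: "R > 0" and w: "cmod w \<le> R / 2"
  shows "log_plus (cmod (f w)) \<le> 3 * proximity R f"
proof -
  define \<alpha> where "\<alpha> = w / of_real R"
  have \<alpha>: "cmod \<alpha> \<le> 1/2" using w R by (simp add: \<alpha>_def norm_divide field_simps)
  define \<psi> where "\<psi> t = log_plus (cmod (f (of_real R * cis t)))" for t
  have cont\<psi>: "continuous_on UNIV \<psi>"
    unfolding \<psi>_def using continuous_on_circle_log_plus[OF hol, of 0 R] by simp
  have cis_per: "cis (x + 2*pi) = cis x" for x by (simp add: complex_eq_iff)
  have per: "\<psi> (x + 2*pi) = \<psi> x" for x by (simp add: \<psi>_def cis_per)
  define \<xi> where "\<xi> t = 1 + \<alpha> * cis (-t)" for t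
  \<comment> \<open>This keeps \<xi> off the branch cut, so \<open>Ln\<close> is differentiable
    along it and \<open>s\<close> is a differentiable lift of the boundary angle.\<close>
  have Re\<xi>: "Re (\<xi> t) > 0" for t
  proof -
    have "\<bar>Re (\<alpha> * cis (-t))\<bar> \<le> 1/2"
      using abs_Re_le_cmod[of "\<alpha> * cis (-t)"] \<alpha> by (simp add: norm_mult)
    then show ?thesis unfolding \<xi>_def plus_complex.simps one_complex.simps by linarith
  qed
  then have \<xi>nz: "\<xi> t \<noteq> 0" for t by (metis less_irrefl zero_complex.simps(1))
  define s where "s t = t + 2 * Im (Ln (\<xi> t))" for t
  \<comment> \<open>\<xi> divided by its conjugate is unimodular with twice the argument of \<xi>,
    so adding \<open>2 * Im (Ln (\<xi> t))\<close> to the angle realises the Moebius map on the unit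
    circle.\<close>
  have cis_s: "cis (s t) = (cis t + \<alpha>) / (1 + cnj \<alpha> * cis t)" for t
  proof -
    have e: "\<xi> t = exp (Ln (\<xi> t))" using \<xi>nz by simp
    define l where "l = Ln (\<xi> t)"
    have "\<xi> t = of_real (exp (Re l)) * cis (Im l)"
      using e by (simp add: l_def exp_eq_polar)
    then have c: "\<xi> t / cnj (\<xi> t) = cis (2 * Im l)"
      by (simp add: cis_cnj cis_divide[symmetric] cis_divide)
    have "cnj (\<xi> t) = 1 + cnj \<alpha> * cis t"
      by (simp add: \<xi>_def cis_cnj)
    moreover have "cis t * \<xi> t = cis t + \<alpha>"
      by (simp add: \<xi>_def algebra_simps cis_mult)
    moreover have "cis (s t) = cis t * cis (2 * Im l)"
      by (simp add: s_def l_def cis_mult)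
    ultimately show ?thesis using c by (metis times_divide_eq_right)
  qed
  define s' where "s' t = Re ((1 - \<alpha> * cis (-t)) / (1 + \<alpha> * cis (-t)))" for t
  have s'_ge: "s' t \<ge> 1/3" for t
    unfolding s'_def using \<alpha> by (intro Re_Moebius_quotient_ge) (simp add: norm_mult)
  have ds: "(s has_real_derivative s' t) (at t)" for t
  proof -
    have "(\<xi> has_vector_derivative (\<alpha> * (- \<i> * cis (-t)))) (at t)"
    proof -
      have "((\<lambda>z. 1 + \<alpha> * exp (- (\<i> * z))) has_field_derivative (\<alpha> * (- \<i> * exp (- (\<i> * of_real t))))) (at (of_real t))"
        by (auto intro!: derivative_eq_intros)
      from has_vector_derivative_real_field[OF this] show ?thesis
        unfolding \<xi>_def cis_conv_exp by simp
    qed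
    then have "(Ln \<circ> \<xi> has_vector_derivative (\<alpha> * (- \<i> * cis (-t)) * inverse (\<xi> t))) (at t)"
      using Re\<xi>[of t] by (intro field_vector_diff_chain_at has_field_derivative_Ln)
         (auto simp: complex_nonpos_Reals_iff)
    then have "((\<lambda>t. Im (Ln (\<xi> t))) has_real_derivative Im (\<alpha> * (- \<i> * cis (-t)) * inverse (\<xi> t))) (at t)"
      unfolding has_real_derivative_iff_has_vector_derivative o_def
      by (rule bounded_linear.has_vector_derivative[OF bounded_linear_Im])
    then have "(s has_real_derivative 1 + 2 * Im (\<alpha> * (- \<i> * cis (-t)) * inverse (\<xi> t))) (at t)"
      unfolding s_def by (intro DERIV_add DERIV_ident DERIV_cmult)
    moreover have "1 + 2 * Im (\<alpha> * (- \<i> * cis (-t)) * inverse (\<xi> t)) = s' t"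
    proof -
      define \<beta> where "\<beta> = \<alpha> * cis (-t)"
      have "s' t = Re ((\<xi> t - 2 * \<beta>) / \<xi> t)" by (simp add: s'_def \<xi>_def \<beta>_def)
      also have "(\<xi> t - 2 * \<beta>) / \<xi> t = 1 - 2 * (\<beta> / \<xi> t)" using \<xi>nz by (simp add: field_simps)
      also have "Re (1 - 2 * u) = 1 - 2 * Re u" for u by simp
      finally have "s' t = 1 - 2 * Re (\<beta> / \<xi> t)" .
      moreover have "\<alpha> * (- \<i> * cis (-t)) * inverse (\<xi> t) = - \<i> * (\<beta> / \<xi> t)"
        by (simp add: \<beta>_def field_simps)
      moreover have "Im (- \<i> * u) = - Re u" for u by simp
      ultimately show ?thesis by (simp only:)
    qed
    ultimately show ?thesis by simp
  qed
  have contS: "continuous_on UNIV s"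
    using ds by (intro DERIV_continuous_on) (auto intro: has_field_derivative_at_within)
  have s_per: "s (t + 2*pi) = s t + 2*pi" for t
  proof -
    have "cis (- t - 2*pi) = cis (-t)" using cis_per[of "-t-2*pi"] by simp
    then show ?thesis by (simp add: s_def \<xi>_def)
  qed
  have cont\<psi>s: "continuous_on UNIV (\<lambda>t. \<psi> (s t))"
    using continuous_on_compose2[OF cont\<psi> contS] by simp
  define g where "g z = f (of_real R * ((z + \<alpha>) / (1 + cnj \<alpha> * z)))" for z
  have dnz: "1 + cnj \<alpha> * z \<noteq> 0" if "cmod z \<le> 1" for z
  proof
    assume "1 + cnj \<alpha> * z = 0"
    then have "cmod (cnj \<alpha> * z) = 1" by (metis add_eq_0_iff norm_minus_cancel norm_one)
    moreover have "cmod (cnj \<alpha> * z) \<le> 1/2 * 1"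
      unfolding norm_mult using \<alpha> that by (intro mult_mono) auto
    ultimately show False by simp
  qed
  have holg: "g holomorphic_on ball 0 1"
    unfolding g_def using dnz
    by (intro holomorphic_on_compose_gen[OF _ hol, unfolded o_def] holomorphic_intros) auto
  have contg: "continuous_on (cball 0 1) g"
    unfolding g_def using dnz
    by (intro continuous_on_compose2[OF holomorphic_on_imp_continuous_on[OF hol]] continuous_intros) auto
  have "cmod (g 0) \<le> exp (1 / (2*pi) * integral {0..2*pi} (\<lambda>t. \<psi> (s t)))"
  proof (rule norm_le_exp_circle_mean[OF _ contg holg cont\<psi>s])
    show "\<psi> (s (x + 2 * pi)) = \<psi> (s x)" for x by (simp add: s_per per)
    show "cmod (g (of_real 1 * cis t)) \<le> exp (\<psi> (s t))" for t
      using exp_log_plus_ge by (simp add: g_def \<psi>_def cis_s)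
  qed simp
  also have "g 0 = f w" using R by (simp add: g_def \<alpha>_def)
  finally have fw: "cmod (f w) \<le> exp (1 / (2*pi) * integral {0..2*pi} (\<lambda>t. \<psi> (s t)))" .
  obtain A where A: "\<And>x. (A has_real_derivative \<psi> x) (at x)"
    using continuous_antiderivative[OF cont\<psi>] by blast
  have AS: "((\<lambda>t. A (s t)) has_real_derivative \<psi> (s t) * s' t) (at t)" for t
    using DERIV_chain2[OF A ds] .
  have int: "((\<lambda>t. \<psi> (s t) * s' t) has_integral A (s (2*pi)) - A (s 0)) {0..2*pi}"
    using AS by (intro fundamental_theorem_of_calculus)
     (auto simp: has_real_derivative_iff_has_vector_derivative[symmetric] intro: has_field_derivative_at_within)
  \<comment> \<open>Since the integrand is nonnegative and the derivative of \<open>s\<close> is at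
    least 1/3, it is dominated by 3 times the derivative of \<open>A (s t)\<close>; integrating that
    derivative performs the change of variable.\<close>
  have "integral {0..2*pi} (\<lambda>t. \<psi> (s t)) \<le> integral {0..2*pi} (\<lambda>t. 3 * (\<psi> (s t) * s' t))"
  proof (rule integral_le)
    show "(\<lambda>t. \<psi> (s t)) integrable_on {0..2*pi}"
      using cont\<psi>s continuous_on_subset by (intro integrable_continuous_real) blast
    show "(\<lambda>t. 3 * (\<psi> (s t) * s' t)) integrable_on {0..2*pi}"
      using int by (intro integrable_on_mult_right) auto
    show "\<psi> (s t) \<le> 3 * (\<psi> (s t) * s' t)" for t
      using mult_left_mono[OF s'_ge[of t], of "\<psi> (s t)"] by (simp add: \<psi>_def log_plus_nonneg)
  qed
  also have "\<dots> = 3 * (A (s (2*pi)) - A (s 0))"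
    using integral_unique[OF int] by simp
  also have "s (2*pi) = s 0 + 2*pi" using s_per[of 0] by simp
  also have "A (s 0 + 2*pi) - A (s 0) = integral {0..2*pi} \<psi>"
    by (rule antiderivative_period[OF A per])
  finally have le: "1 / (2*pi) * integral {0..2*pi} (\<lambda>t. \<psi> (s t)) \<le> 3 * proximity R f"
    by (simp add: proximity_def \<psi>_def[symmetric] divide_right_mono)
  have ge0: "0 \<le> 3 * proximity R f"
    using proximity_nonneg by simp
  have "cmod (f w) \<le> exp (3 * proximity R f)"
    using fw le by (smt (verit) exp_le_cancel_iff)
  then have "max 1 (cmod (f w)) \<le> exp (3 * proximity R f)" using ge0 by simp
  then show ?thesis
    unfolding log_plus_def by (metis exp_gt_zero ln_exp ln_le_cancel_iff max.strict_coboundedI1 zero_less_one)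
qed

section \<open>Growth of entire functions\<close>

text \<open>For k \<ge> 1 this is order at most k and finite type. The base
  \<open>1 + cmod z\<close> is at least 1, so sums, products, shifts and derivatives merely change
  \<open>C\<close>, without a separate treatment of small \<open>z\<close>.\<close>

definition exp_growth :: "nat \<Rightarrow> (complex \<Rightarrow> complex) set" where
  "exp_growth k = {g. g holomorphic_on UNIV \<and> (\<exists>C\<ge>0. \<forall>z. cmod (g z) \<le> exp (C * (1 + cmod z) ^ k))}"

lemma exp_growthI:
  assumes "g holomorphic_on UNIV" "C \<ge> 0" "\<And>z. cmod (g z) \<le> exp (C * (1 + cmod z) ^ k)"
  shows "g \<in> exp_growth k"
  using assms unfolding exp_growth_def by blast

lemma exp_growth_holomorphic: "g \<in> exp_growth k \<Longrightarrow> g holomorphic_on UNIV"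
  unfolding exp_growth_def by blast

lemma exp_growth_const [simp]: "(\<lambda>z. w) \<in> exp_growth k"
proof (rule exp_growthI)
  show "cmod w \<le> exp (cmod w * (1 + cmod z) ^ k)" for z
  proof -
    have "cmod w * 1 \<le> cmod w * (1 + cmod z) ^ k"
      by (intro mult_left_mono) auto
    then show ?thesis using exp_ge_add_one_self[of "cmod w * (1 + cmod z) ^ k"] by linarith
  qed
qed auto

lemma exp_growth_add:
  assumes "f \<in> exp_growth k" "g \<in> exp_growth k"
  shows "(\<lambda>z. f z + g z) \<in> exp_growth k"
proof -
  obtain A where A: "f holomorphic_on UNIV" "A \<ge> 0" "\<And>z. cmod (f z) \<le> exp (A * (1 + cmod z) ^ k)"
    using assms(1) unfolding exp_growth_def by blast
  obtain B where B: "g holomorphic_on UNIV" "B \<ge> 0" "\<And>z. cmod (g z) \<le> exp (B * (1 + cmod z) ^ k)"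
    using assms(2) unfolding exp_growth_def by blast
  show ?thesis
  proof (rule exp_growthI)
    show "cmod (f z + g z) \<le> exp ((A + B + 1) * (1 + cmod z) ^ k)" for z
    proof -
      define X where "X = (1 + cmod z) ^ k"
      have X: "X \<ge> 1" by (simp add: X_def)
      have AX: "A * X \<le> (A + B) * X" "B * X \<le> (A + B) * X"
        using A(2) B(2) X by (auto intro!: mult_right_mono)
      have "cmod (f z + g z) \<le> exp (A * X) + exp (B * X)"
        unfolding X_def by (rule norm_triangle_le[OF add_mono[OF A(3) B(3)]])
      also have "\<dots> \<le> exp ((A + B) * X) + exp ((A + B) * X)"
        using AX by (intro add_mono) simp_all
      also have "\<dots> = 2 * exp ((A + B) * X)" by simp
      also have "\<dots> \<le> exp X * exp ((A + B) * X)"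
        using order_trans[OF _ exp_ge_add_one_self[of X], of 2] X by (intro mult_right_mono) auto
      also have "\<dots> = exp ((A + B + 1) * X)"
        unfolding mult_exp_exp by (rule arg_cong[where f = exp]) (simp add: distrib_right)
      finally show ?thesis by (simp add: X_def)
    qed
    show "(\<lambda>z. f z + g z) holomorphic_on UNIV" using A(1) B(1) by (intro holomorphic_intros)
    show "A + B + 1 \<ge> 0" using A(2) B(2) by simp
  qed
qed

lemma exp_growth_mult:
  assumes "f \<in> exp_growth k" "g \<in> exp_growth k"
  shows "(\<lambda>z. f z * g z) \<in> exp_growth k"
proof -
  obtain A where A: "f holomorphic_on UNIV" "A \<ge> 0" "\<And>z. cmod (f z) \<le> exp (A * (1 + cmod z) ^ k)"
    using assms(1) unfolding exp_growth_def by blast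
  obtain B where B: "g holomorphic_on UNIV" "B \<ge> 0" "\<And>z. cmod (g z) \<le> exp (B * (1 + cmod z) ^ k)"
    using assms(2) unfolding exp_growth_def by blast
  have "cmod (f z * g z) \<le> exp ((A + B) * (1 + cmod z) ^ k)" for z
    using mult_mono[OF A(3)[of z] B(3)[of z]] by (simp add: norm_mult distrib_right exp_add)
  moreover have "(\<lambda>z. f z * g z) holomorphic_on UNIV" using A(1) B(1) by (intro holomorphic_intros)
  moreover have "A + B \<ge> 0" using A(2) B(2) by simp
  ultimately show ?thesis by (intro exp_growthI)
qed

lemma exp_growth_cmult: "g \<in> exp_growth k \<Longrightarrow> (\<lambda>z. w * g z) \<in> exp_growth k"
  by (intro exp_growth_mult exp_growth_const)

lemma exp_growth_diff:
  assumes "f \<in> exp_growth k" "g \<in> exp_growth k"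
  shows "(\<lambda>z. f z - g z) \<in> exp_growth k"
  using exp_growth_add[OF assms(1) exp_growth_cmult[OF assms(2), of "-1"]] by simp

lemma one_plus_norm_add_power_le: "(1 + cmod (z + w)) ^ k \<le> (1 + cmod w) ^ k * (1 + cmod z) ^ k"
proof -
  have "1 + cmod (z + w) \<le> (1 + cmod w) * (1 + cmod z)"
  proof -
    have "(1 + cmod w) * (1 + cmod z) = 1 + cmod z + cmod w + cmod w * cmod z"
      by (simp add: algebra_simps)
    then show ?thesis
      using norm_triangle_ineq[of z w] mult_nonneg_nonneg[OF norm_ge_zero norm_ge_zero, of w z] by linarith
  qed
  then show ?thesis unfolding power_mult_distrib[symmetric] by (intro power_mono) auto
qed

lemma entire_shift:
  assumes "g holomorphic_on UNIV"
  shows "(\<lambda>z. g (z + w)) holomorphic_on UNIV"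
  by (rule holomorphic_on_compose_gen[OF _ assms, unfolded o_def]) (auto intro!: holomorphic_intros)

lemma exp_growth_shift:
  assumes "g \<in> exp_growth k"
  shows "(\<lambda>z. g (z + w)) \<in> exp_growth k"
proof -
  obtain B where B: "g holomorphic_on UNIV" "B \<ge> 0" "\<And>z. cmod (g z) \<le> exp (B * (1 + cmod z) ^ k)"
    using assms unfolding exp_growth_def by blast
  show ?thesis
  proof (rule exp_growthI)
    show "(\<lambda>z. g (z + w)) holomorphic_on UNIV"
      by (rule entire_shift[OF B(1)])
    show "cmod (g (z + w)) \<le> exp ((B * (1 + cmod w) ^ k) * (1 + cmod z) ^ k)" for z
    proof -
      have "B * (1 + cmod (z + w)) ^ k \<le> B * ((1 + cmod w) ^ k * (1 + cmod z) ^ k)"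
        using B(2) one_plus_norm_add_power_le by (intro mult_left_mono) auto
      then show ?thesis using order_trans[OF B(3)[of "z + w"]] by (simp add: mult.assoc)
    qed
  qed (use B(2) in auto)
qed

text \<open>Cauchy's estimate on the unit circle about \<open>z\<close>, where 1 + |x| \<le> 2 (1 +
  |z|); hence the factor \<open>2 ^ k\<close>.\<close>

lemma exp_growth_deriv:
  assumes "g \<in> exp_growth k"
  shows "deriv g \<in> exp_growth k"
proof -
  obtain B where B: "g holomorphic_on UNIV" "B \<ge> 0" "\<And>z. cmod (g z) \<le> exp (B * (1 + cmod z) ^ k)"
    using assms unfolding exp_growth_def by blast
  show ?thesis
  proof (rule exp_growthI)
    show "deriv g holomorphic_on UNIV" using B(1) by (intro holomorphic_intros) auto
    show "cmod (deriv g z) \<le> exp ((B * 2 ^ k) * (1 + cmod z) ^ k)" for z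
    proof -
      have "norm ((deriv ^^ 1) g z) \<le> fact 1 * exp ((B * 2 ^ k) * (1 + cmod z) ^ k) / 1 ^ 1"
      proof (rule Cauchy_inequality)
        show "g holomorphic_on ball z 1" "continuous_on (cball z 1) g"
          using B(1) holomorphic_on_subset holomorphic_on_imp_continuous_on by blast+
        fix x assume "norm (z - x) = 1"
        then have "(1 + cmod x) ^ k \<le> 2 ^ k * (1 + cmod z) ^ k"
          using one_plus_norm_add_power_le[of z "x - z" k] by (simp add: norm_minus_commute)
        then have "B * (1 + cmod x) ^ k \<le> B * (2 ^ k * (1 + cmod z) ^ k)"
          using B(2) by (intro mult_left_mono) auto
        then show "norm (g x) \<le> exp ((B * 2 ^ k) * (1 + cmod z) ^ k)"
          using order_trans[OF B(3)[of x]] by (simp add: mult.assoc)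
      qed auto
      then show ?thesis by simp
    qed
  qed (use B(2) in auto)
qed

lemma norm_poly_le:
  fixes p :: "complex poly"
  assumes "degree p \<le> k"
  obtains C where "C \<ge> 0" "\<And>z. cmod (poly p z) \<le> C * (1 + cmod z) ^ k"
proof
  show "(\<Sum>i\<le>degree p. cmod (coeff p i)) \<ge> 0" by (intro sum_nonneg) auto
  fix z
  have "cmod (poly p z) \<le> (\<Sum>i\<le>degree p. cmod (coeff p i) * cmod z ^ i)"
    unfolding poly_altdef by (rule order_trans[OF norm_sum]) (simp add: norm_mult norm_power)
  also have "\<dots> \<le> (\<Sum>i\<le>degree p. cmod (coeff p i) * (1 + cmod z) ^ k)"
  proof (intro sum_mono mult_left_mono)
    fix i assume "i \<in> {..degree p}"
    have "cmod z ^ i \<le> (1 + cmod z) ^ i" by (intro power_mono) auto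
    also have "\<dots> \<le> (1 + cmod z) ^ k" using \<open>i \<in> _\<close> assms by (intro power_increasing) auto
    finally show "cmod z ^ i \<le> (1 + cmod z) ^ k" .
  qed auto
  finally show "cmod (poly p z) \<le> (\<Sum>i\<le>degree p. cmod (coeff p i)) * (1 + cmod z) ^ k"
    by (simp add: sum_distrib_right)
qed

lemma exp_growth_poly:
  assumes "degree p \<le> k"
  shows "poly p \<in> exp_growth k"
proof -
  obtain C where C: "C \<ge> 0" "\<And>z. cmod (poly p z) \<le> C * (1 + cmod z) ^ k"
    using norm_poly_le[OF assms] by blast
  show ?thesis
  proof (rule exp_growthI[OF _ C(1)])
    show "poly p holomorphic_on UNIV" by (intro holomorphic_intros)
    show "cmod (poly p z) \<le> exp (C * (1 + cmod z) ^ k)" for z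
      using C(2)[of z] exp_ge_add_one_self[of "C * (1 + cmod z) ^ k"] by linarith
  qed
qed

lemma exp_growth_exp_poly:
  assumes "degree p \<le> k"
  shows "(\<lambda>z. exp (poly p z)) \<in> exp_growth k"
proof -
  obtain C where C: "C \<ge> 0" "\<And>z. cmod (poly p z) \<le> C * (1 + cmod z) ^ k"
    using norm_poly_le[OF assms] by blast
  show ?thesis
  proof (rule exp_growthI[OF _ C(1)])
    show "(\<lambda>z. exp (poly p z)) holomorphic_on UNIV" by (intro holomorphic_intros)
    show "cmod (exp (poly p z)) \<le> exp (C * (1 + cmod z) ^ k)" for z
      using C(2)[of z] complex_Re_le_cmod[of "poly p z"] by simp
  qed
qed

section \<open>Polynomial exponents\<close>

text \<open>Entire functions form an integral domain: \<open>g\<close> vanishes on the open set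
  where \<open>f\<close> is nonzero, which accumulates at \<open>w\<close>.\<close>

lemma entire_mult_eq_0:
  assumes "f holomorphic_on UNIV" "g holomorphic_on UNIV" "\<And>z. f z * g z = 0" "f w \<noteq> 0"
  shows "g z = 0"
proof -
  have "continuous_on UNIV f" using assms(1) holomorphic_on_imp_continuous_on by blast
  then have op: "open {z. f z \<noteq> 0}"
    using open_Collect_neq[of f "\<lambda>_. 0"] continuous_on_const by auto
  have lim: "w islimpt {z. f z \<noteq> 0}"
    using assms(4) op interior_limit_point[of w "{z. f z \<noteq> 0}"] by (simp add: interior_open)
  show ?thesis
    by (rule analytic_continuation[OF assms(2) open_UNIV connected_UNIV _ UNIV_I lim])
       (use assms(3) in auto)
qed

text \<open>The map u / (2 M - u) sends the half-plane Re u < M into the unit disc and fixes 0. The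
  Schwarz lemma on the disc of radius 2 r bounds the image by 1/2 on |z| \<le> r, and then |u| \<le>
  (2 M + |u|) / 2 gives the bound.\<close>

lemma Borel_Caratheodory:
  assumes hol: "h holomorphic_on UNIV" and "M > 0" "r > 0"
    and le: "\<And>z. cmod z < 2 * r \<Longrightarrow> Re (h z) - Re (h 0) < M"
    and z: "cmod z \<le> r"
  shows "cmod (h z - h 0) \<le> 2 * M"
proof -
  define g where "g w = (h (2 * of_real r * w) - h 0) / (2 * of_real M - (h (2 * of_real r * w) - h 0))" for w
  have dom: "cmod (2 * of_real r * w) < 2 * r" if "cmod w < 1" for w
    using that \<open>r > 0\<close> by (simp add: norm_mult)
  have nz: "2 * of_real M - (h (2 * of_real r * w) - h 0) \<noteq> 0" if "cmod w < 1" for w :: complex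
  proof
    assume "2 * of_real M - (h (2 * of_real r * w) - h 0) = 0"
    then have "Re (h (2 * of_real r * w)) - Re (h 0) = 2 * M"
      by (simp add: complex_eq_iff)
    then show False using le[OF dom[OF that]] \<open>M > 0\<close> by linarith
  qed
  have holg: "g holomorphic_on ball 0 1"
    unfolding g_def using nz
    by (intro holomorphic_intros holomorphic_on_compose_gen[OF _ hol, unfolded o_def]) auto
  have g1: "cmod (g w) < 1" if "cmod w < 1" for w
  proof -
    define u where "u = h (2 * of_real r * w) - h 0"
    have "Re u < M" using le[OF dom[OF that]] by (simp add: u_def)
    then have "(Re u)\<^sup>2 < (2 * M - Re u)\<^sup>2"
      using \<open>M > 0\<close> mult_strict_left_mono[of "Re u" M "4*M"]
      by (simp add: power2_eq_square algebra_simps)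
    then have "(cmod u)\<^sup>2 < (cmod (2 * of_real M - u))\<^sup>2" by (simp add: cmod_power2)
    then have "cmod u < cmod (2 * of_real M - u)" by (rule power2_less_imp_less) auto
    moreover have "2 * of_real M - u \<noteq> 0" using nz[OF that] by (simp add: u_def)
    ultimately show ?thesis by (simp add: g_def u_def[symmetric] norm_divide)
  qed
  define w where "w = z / of_real (2 * r)"
  have w: "cmod w \<le> 1/2" using z \<open>r > 0\<close> by (simp add: w_def norm_divide field_simps)
  define u where "u = h z - h 0"
  have zw: "2 * of_real r * w = z" using \<open>r > 0\<close> by (simp add: w_def)
  have gw: "g w = u / (2 * of_real M - u)" by (simp add: g_def zw u_def)
  have "cmod (g w) \<le> cmod w"
    using w by (intro Schwarz_Lemma(1)[OF holg]) (auto simp: g1, simp add: g_def)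
  then have g2: "cmod (g w) \<le> 1/2" using w by linarith
  have d: "2 * of_real M - u \<noteq> 0" using nz[of w] w by (simp add: zw u_def)
  have "u = g w * (2 * of_real M - u)" using d by (simp add: gw)
  then have "cmod u = cmod (g w) * cmod (2 * of_real M - u)" by (metis norm_mult)
  also have "\<dots> \<le> 1/2 * (2 * M + cmod u)"
    using g2 norm_triangle_ineq4[of "2 * of_real M" u] \<open>M > 0\<close> by (intro mult_mono) auto
  finally show ?thesis by (simp add: u_def)
qed

lemma entire_Re_le_imp_poly:
  assumes hol: "h holomorphic_on UNIV" and "C \<ge> 0"
    and le: "\<And>z. Re (h z) \<le> C * (1 + cmod z) ^ k"
  obtains p where "degree p \<le> k" "h = poly p"
proof -
  \<comment> \<open>For r = |z| \<ge> 1, points of the disc of radius 2 r satisfy 1 + |w| \<le> 3 r,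
    whence \<open>3 ^ k\<close>. The second summand pays for subtracting \<open>Re (h 0)\<close>,
    and the last one makes the inequality strict.\<close>
  define D where "D = C * 3 ^ k + \<bar>Re (h 0)\<bar> + 1"
  have bd: "cmod (h z) \<le> (2 * D + cmod (h 0)) * cmod z ^ k" if "1 \<le> cmod z" for z
  proof -
    define r where "r = cmod z"
    have r: "r \<ge> 1" using that by (simp add: r_def)
    have rk: "r ^ k \<ge> 1" using r by simp
    have "cmod (h z - h 0) \<le> 2 * (D * r ^ k)"
    proof (rule Borel_Caratheodory[OF hol])
      show "D * r ^ k > 0" using r \<open>C \<ge> 0\<close> by (simp add: D_def add_nonneg_pos)
      show "Re (h w) - Re (h 0) < D * r ^ k" if "cmod w < 2 * r" for w
      proof -
        have "(1 + cmod w) ^ k \<le> (3 * r) ^ k" using that r by (intro power_mono) auto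
        then have "C * (1 + cmod w) ^ k \<le> C * 3 ^ k * r ^ k"
          using mult_left_mono[OF _ \<open>C \<ge> 0\<close>] by (simp add: power_mult_distrib mult.assoc)
        moreover have "\<bar>Re (h 0)\<bar> + 1 \<le> (\<bar>Re (h 0)\<bar> + 1) * r ^ k"
          using rk by (simp add: mult_le_cancel_left1)
        ultimately show ?thesis using le[of w] unfolding D_def distrib_right by linarith
      qed
    qed (use r in \<open>auto simp: r_def\<close>)
    moreover have "cmod (h 0) \<le> cmod (h 0) * r ^ k" using rk by (simp add: mult_le_cancel_left1)
    ultimately show ?thesis
      using norm_triangle_ineq[of "h z - h 0" "h 0"] by (simp add: r_def distrib_right)
  qed
  define p where "p = (\<Sum>i\<le>k. monom ((deriv ^^ i) h 0 / fact i) i)"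
  have "h z = poly p z" for z
    using Liouville_polynomial[OF hol bd, where \<xi> = z] by (simp add: p_def poly_sum poly_monom)
  moreover have "degree p \<le> k"
    unfolding p_def by (intro degree_sum_le) (auto intro: order_trans[OF degree_monom_le])
  ultimately show ?thesis using that by blast
qed

text \<open>On a circle \<open>\<bar>V\<bar> exp (max 0 (Re p)) = max \<bar>V\<bar> \<bar>U\<bar>\<close>, so Jensen's inequality for \<open>V\<close>
  bounds the mean of \<open>max 0 (Re p)\<close>.\<close>

lemma entire_exponent_poly:
  assumes p: "p holomorphic_on UNIV" and U: "U \<in> exp_growth k" and V: "V \<in> exp_growth k"
    and nz: "V z0 \<noteq> 0" and eq: "\<And>z. exp (p z) * V z = U z"
  obtains P where "degree P \<le> k" "p = poly P"
proof -
  \<comment> \<open>Recentring at \<open>z0\<close> makes \<open>V'\<close> nonzero at the origin,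
    the point at which the circle mean bounds it.\<close>
  define V' where "V' z = V (z + z0)" for z
  define p' where "p' z = p (z + z0)" for z
  obtain A where A: "A \<ge> 0" "\<And>z. cmod (U (z + z0)) \<le> exp (A * (1 + cmod z) ^ k)"
    using exp_growth_shift[OF U, of z0] unfolding exp_growth_def by blast
  obtain B where B: "V' holomorphic_on UNIV" "B \<ge> 0" "\<And>z. cmod (V' z) \<le> exp (B * (1 + cmod z) ^ k)"
    using exp_growth_shift[OF V, of z0] unfolding V'_def unfolding exp_growth_def by blast
  have holp': "p' holomorphic_on UNIV"
    unfolding p'_def by (rule entire_shift[OF p])
  have hole: "(\<lambda>z. exp (p' z)) holomorphic_on UNIV"
    using holp' by (intro holomorphic_intros)
  have lp: "log_plus (cmod (exp w)) = max 0 (Re w)" for w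
    by (simp add: log_plus_def max_def)
  have prox: "proximity R (\<lambda>z. exp (p' z)) \<le> (A + B) * (1 + R) ^ k - ln (cmod (V z0))" if "R > 0" for R
  proof -
    define L where "L = (A + B) * (1 + R) ^ k"
    define \<psi> where "\<psi> t = L - log_plus (cmod (exp (p' (of_real R * cis t))))" for t
    have c: "continuous_on UNIV (\<lambda>t. log_plus (cmod (exp (p' (of_real R * cis t)))))"
      using continuous_on_circle_log_plus[OF hole, of 0 R] by simp
    have cis_per: "cis (x + 2*pi) = cis x" for x by (simp add: complex_eq_iff)
    have "cmod (V' 0) \<le> exp (1 / (2*pi) * integral {0..2*pi} \<psi>)"
    proof (rule norm_le_exp_circle_mean[OF that])
      show "continuous_on (cball 0 R) V'" "V' holomorphic_on ball 0 R"
        using B(1) holomorphic_on_imp_continuous_on holomorphic_on_subset by blast+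
      show "continuous_on UNIV \<psi>" unfolding \<psi>_def using c by (intro continuous_intros)
      show "\<psi> (x + 2*pi) = \<psi> x" for x by (simp add: \<psi>_def cis_per)
      fix t
      define z where "z = of_real R * cis t"
      have z: "cmod z = R" using that by (simp add: z_def norm_mult)
      have LA: "A * (1 + R) ^ k \<le> L" and LB: "B * (1 + R) ^ k \<le> L"
        using A(1) B(2) that by (auto simp: L_def distrib_right)
      have "cmod (V' z) \<le> exp L"
        using order_trans[OF B(3)[of z]] LB by (simp add: z)
      moreover have "exp (p' z) * V' z = U (z + z0)" by (simp add: p'_def V'_def eq)
      then have "exp (Re (p' z)) * cmod (V' z) \<le> exp L"
        using order_trans[OF A(2)[of z], of "exp L"] LA by (simp add: z flip: norm_mult norm_exp_eq_Re)
      ultimately have "exp (max 0 (Re (p' z))) * cmod (V' z) \<le> exp L"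
        by (simp add: max_def)
      then have "cmod (V' z) \<le> exp (L - max 0 (Re (p' z)))"
        by (simp add: exp_diff field_simps)
      then show "cmod (V' (of_real R * cis t)) \<le> exp (\<psi> t)"
        unfolding \<psi>_def z_def[symmetric] lp .
    qed
    also have "integral {0..2*pi} \<psi> = 2 * pi * L - integral {0..2*pi} (\<lambda>t. log_plus (cmod (exp (p' (of_real R * cis t)))))"
      unfolding \<psi>_def using c continuous_on_subset
      by (subst integral_diff) (auto intro!: integrable_continuous_real)
    also have "1 / (2*pi) * \<dots> = L - proximity R (\<lambda>z. exp (p' z))"
      by (simp add: proximity_def right_diff_distrib)
    finally have "ln (cmod (V' 0)) \<le> L - proximity R (\<lambda>z. exp (p' z))"
      using nz ln_le_cancel_iff[of "cmod (V' 0)" "exp (L - proximity R (\<lambda>z. exp (p' z)))"]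
      by (simp add: V'_def)
    then show ?thesis by (simp add: V'_def L_def)
  qed
  \<comment> \<open>The outer 3 comes from \<open>log_plus_le_proximity\<close> on the circle of
    radius R = 2 (1 + |z|), and \<open>3 ^ k\<close> from 1 + R \<le> 3 (1 + |z|).\<close>
  define K where "K = 3 * ((A + B) * 3 ^ k + \<bar>ln (cmod (V z0))\<bar>)"
  have "Re (p' z) \<le> K * (1 + cmod z) ^ k" for z
  proof -
    define R where "R = 2 * (1 + cmod z)"
    have R: "R > 0" by (simp add: R_def add_pos_nonneg)
    have "Re (p' z) \<le> 3 * proximity R (\<lambda>z. exp (p' z))"
      using log_plus_le_proximity[OF hole R, of z] unfolding lp by (simp add: R_def)
    also have "\<dots> \<le> 3 * ((A + B) * (1 + R) ^ k + \<bar>ln (cmod (V z0))\<bar>)"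
      using prox[OF R] by (intro mult_left_mono) linarith+
    also have "\<dots> \<le> 3 * ((A + B) * (3 ^ k * (1 + cmod z) ^ k) + \<bar>ln (cmod (V z0))\<bar> * (1 + cmod z) ^ k)"
    proof (intro mult_left_mono add_mono)
      show "(1 + R) ^ k \<le> 3 ^ k * (1 + cmod z) ^ k"
        unfolding power_mult_distrib[symmetric] by (intro power_mono) (auto simp: R_def)
      show "\<bar>ln (cmod (V z0))\<bar> \<le> \<bar>ln (cmod (V z0))\<bar> * (1 + cmod z) ^ k"
        by (simp add: mult_le_cancel_left1)
    qed (use A B in auto)
    also have "\<dots> = K * (1 + cmod z) ^ k" by (simp add: K_def algebra_simps)
    finally show ?thesis .
  qed
  moreover have "K \<ge> 0" using A B by (simp add: K_def)
  ultimately obtain P where P: "degree P \<le> k" "p' = poly P"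
    using entire_Re_le_imp_poly[OF holp'] by blast
  have "p z = poly (pcompose P [:-z0, 1:]) z" for z
  proof -
    have "p z = p' (z - z0)" by (simp add: p'_def)
    also have "\<dots> = poly (pcompose P [:-z0, 1:]) z" by (simp add: P(2) poly_pcompose)
    finally show ?thesis .
  qed
  moreover have "degree (pcompose P [:-z0, 1:]) \<le> k" using P(1) by (simp add: degree_pcompose)
  ultimately show ?thesis using that by blast
qed

section \<open>Consequences of finite order, smallness and shared zeros\<close>

lemma nevanlinna_T_entire:
  assumes "g holomorphic_on UNIV"
  shows "nevanlinna_T r g = proximity r g"
proof -
  have "\<not> is_pole g z" for z
    using not_is_pole_holomorphic[OF open_UNIV UNIV_I assms] .
  then have "pole_count t g = 0" for t by (simp add: pole_count_def)
  then show ?thesis by (simp add: nevanlinna_T_def pole_counting_def)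
qed

text \<open>Any circle of radius r \<ge> 2 |z| controls the value at \<open>z\<close>, so one good
  radius in every interval [R, \<mu> R] suffices, at the cost of a factor \<mu>^k. This is how an
  exceptional set of radii is bypassed.\<close>

lemma exp_growth_if_proximity_le:
  assumes hol: "g holomorphic_on UNIV" and "\<mu> > 0"
    and le: "\<And>R. R \<ge> R0 \<Longrightarrow> \<exists>r\<ge>R. r \<le> \<mu> * R \<and> proximity r g \<le> r ^ k"
  shows "g \<in> exp_growth k"
proof (rule exp_growthI[OF hol])
  define M where "M = max 1 R0"
  show "3 * (\<mu> * (2 * M)) ^ k \<ge> 0" using \<open>\<mu> > 0\<close> by (simp add: M_def)
  show "cmod (g z) \<le> exp (3 * (\<mu> * (2 * M)) ^ k * (1 + cmod z) ^ k)" for z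
  proof -
    have M: "M \<ge> 1" "M \<ge> R0" by (auto simp: M_def)
    have le1: "M * 1 \<le> M * (2 * (1 + cmod z))"
      using M by (intro mult_left_mono) (simp_all add: add_increasing2)
    have le2: "1 * (2 * (1 + cmod z)) \<le> M * (2 * (1 + cmod z))"
      using M by (intro mult_right_mono) simp_all
    \<comment> \<open>The factor 2 puts \<open>z\<close> within half the radius; \<open>M\<close>
      brings the radius past \<open>R0\<close>.\<close>
    obtain r where r: "r \<ge> M * (2 * (1 + cmod z))" "r \<le> \<mu> * (M * (2 * (1 + cmod z)))" "proximity r g \<le> r ^ k"
      using le[of "M * (2 * (1 + cmod z))"] order_trans[OF M(2)] le1 by auto
    have rpos: "r > 0" using r(1) le1 M by linarith
    have "2 * (1 + cmod z) \<le> r" using order_trans[OF le2 r(1)] by simp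
    then have "cmod z \<le> r / 2" by (simp add: field_simps)
    then have "log_plus (cmod (g z)) \<le> 3 * proximity r g"
      by (rule log_plus_le_proximity[OF hol rpos])
    also have "\<dots> \<le> 3 * (\<mu> * (M * (2 * (1 + cmod z)))) ^ k"
      using r(3) power_mono[OF r(2), of k] rpos by linarith
    also have "\<dots> = 3 * (\<mu> * (2 * M)) ^ k * (1 + cmod z) ^ k"
      unfolding mult.assoc[of 3] power_mult_distrib[symmetric] by (simp only: mult_ac)
    finally have "exp (log_plus (cmod (g z))) \<le> exp (3 * (\<mu> * (2 * M)) ^ k * (1 + cmod z) ^ k)"
      by simp
    then show ?thesis using exp_log_plus_ge order_trans by blast
  qed
qed

lemma finite_order_proximity_le:
  assumes hol: "f holomorphic_on UNIV" and fin: "finite_order f"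
  obtains k R0 where "\<And>r. r \<ge> R0 \<Longrightarrow> proximity r f \<le> r ^ k"
proof -
  obtain K where K: "growth_order f < ereal K"
    using fin ereal_dense2 unfolding finite_order_def by blast
  define k where "k = nat \<lceil>K\<rceil>"
  have Kk: "K \<le> real k" unfolding k_def by linarith
  have "\<forall>\<^sub>F r in at_top. ereal (log_plus (nevanlinna_T r f) / ln r) < ereal K"
    using K unfolding growth_order_def by (rule Limsup_lessD)
  moreover have "\<forall>\<^sub>F r::real in at_top. r > 1" by (rule eventually_gt_at_top)
  ultimately have "\<forall>\<^sub>F r in at_top. proximity r f \<le> r ^ k"
  proof eventually_elim
    case (elim r)
    have "ln r > 0" using elim by simp
    then have "log_plus (proximity r f) < K * ln r"
      using elim by (simp add: nevanlinna_T_entire[OF hol] field_simps)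
    also have "\<dots> \<le> real k * ln r" using Kk \<open>ln r > 0\<close> by (intro mult_right_mono) auto
    finally have "exp (log_plus (proximity r f)) \<le> exp (real k * ln r)" by simp
    also have "\<dots> = r ^ k" using elim by (simp add: exp_of_nat_mult)
    finally show ?case using exp_log_plus_ge order_trans by blast
  qed
  then show ?thesis using that unfolding eventually_at_top_linorder by blast
qed

lemma nn_integral_inverse_Icc:
  fixes R \<mu> :: real
  assumes "R > 0" "\<mu> \<ge> 1"
  shows "(\<integral>\<^sup>+ r \<in> {R..\<mu> * R}. ennreal (1 / r) \<partial>lebesgue) = ennreal (ln \<mu>)"
proof -
  have "(\<integral>\<^sup>+ r \<in> {R..\<mu> * R}. ennreal (1 / r) \<partial>lebesgue) = (\<integral>\<^sup>+ r \<in> {R..\<mu> * R}. ennreal (1 / r) \<partial>lborel)"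
    by (rule nn_integral_completion) measurable
  also have "\<dots> = ennreal (ln (\<mu> * R) - ln R)"
  proof (rule nn_integral_FTC_Icc)
    show "(ln has_real_derivative 1 / x) (at x)" if "x \<in> {R..\<mu> * R}" for x
      using that \<open>R > 0\<close> by (auto intro!: derivative_eq_intros simp: divide_simps)
    show "R \<le> \<mu> * R" using assms by simp
  qed (use assms in auto)
  also have "ln (\<mu> * R) - ln R = ln \<mu>" using assms by (simp add: ln_mult)
  finally show ?thesis .
qed

text \<open>The interval [R, \<mu> R] has logarithmic measure ln \<mu> for every R. Taking ln \<mu>
  to be one more than the measure of \<open>E\<close> prevents \<open>E\<close> from containing
  it.\<close>

lemma finite_log_measure_gap:
  assumes "finite_log_measure E"
  obtains \<mu> where "\<mu> > 0" "\<And>R. R > 0 \<Longrightarrow> \<exists>r\<ge>R. r \<le> \<mu> * R \<and> r \<notin> E"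
proof -
  define m where "m = enn2real (\<integral>\<^sup>+ r \<in> E. ennreal (1 / r) \<partial>lebesgue)"
  have m: "(\<integral>\<^sup>+ r \<in> E. ennreal (1 / r) \<partial>lebesgue) = ennreal m" "m \<ge> 0"
    using assms unfolding finite_log_measure_def m_def by simp_all
  show ?thesis
  proof (rule that[of "exp (m + 1)"])
    fix R :: real assume R: "R > 0"
    show "\<exists>r\<ge>R. r \<le> exp (m + 1) * R \<and> r \<notin> E"
    proof (rule ccontr)
      assume "\<not> (\<exists>r\<ge>R. r \<le> exp (m + 1) * R \<and> r \<notin> E)"
      then have sub: "{R..exp (m + 1) * R} \<subseteq> E" by auto
      have "ennreal (m + 1) = (\<integral>\<^sup>+ r \<in> {R..exp (m + 1) * R}. ennreal (1 / r) \<partial>lebesgue)"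
        using nn_integral_inverse_Icc[OF R, of "exp (m + 1)"] m(2) by simp
      also have "\<dots> \<le> (\<integral>\<^sup>+ r \<in> E. ennreal (1 / r) \<partial>lebesgue)"
        using sub by (intro nn_integral_mono) (auto simp: indicator_def)
      finally show False using m by simp
    qed
  qed simp
qed

text \<open>Smallness enters as T(r, g) \<le> T(r, f) for large r off the exceptional set, and the
  gap lemma supplies enough such radii.\<close>

lemma small_function_exp_growth:
  assumes hol: "f holomorphic_on UNIV" and le: "\<And>r. r \<ge> R0 \<Longrightarrow> proximity r f \<le> r ^ k"
    and g: "g holomorphic_on UNIV" "g \<in> small_functions f"
  shows "g \<in> exp_growth k"
proof -
  obtain E where E: "finite_log_measure E"
    and o: "(\<lambda>r. nevanlinna_T r g) \<in> o[inf at_top (principal (- E))](\<lambda>r. nevanlinna_T r f)"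
    using g(2) unfolding small_functions_def is_S_def by blast
  have "\<forall>\<^sub>F r in inf at_top (principal (- E)). norm (nevanlinna_T r g) \<le> 1 * norm (nevanlinna_T r f)"
    using landau_o.smallD[OF o, of 1] by simp
  then obtain R1 where R1: "\<And>r. r \<ge> R1 \<Longrightarrow> r \<notin> E \<Longrightarrow> proximity r g \<le> proximity r f"
    unfolding eventually_inf_principal eventually_at_top_linorder
    by (auto simp: nevanlinna_T_entire hol g(1) proximity_nonneg)
  obtain \<mu> where \<mu>: "\<mu> > 0" "\<And>R. R > 0 \<Longrightarrow> \<exists>r\<ge>R. r \<le> \<mu> * R \<and> r \<notin> E"
    using finite_log_measure_gap[OF E] by blast
  show ?thesis
  proof (rule exp_growth_if_proximity_le[OF g(1) \<mu>(1)])
    fix R assume R: "R \<ge> max 1 (max R0 R1)"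
    then obtain r where r: "r \<ge> R" "r \<le> \<mu> * R" "r \<notin> E" using \<mu>(2)[of R] by auto
    then have "proximity r g \<le> r ^ k"
      using order_trans[OF R1 le, of r] R by simp
    then show "\<exists>r\<ge>R. r \<le> \<mu> * R \<and> proximity r g \<le> r ^ k" using r by blast
  qed
qed

text \<open>Equal zero orders make the quotient a zero-free entire function, which has a holomorphic
  logarithm on the plane.\<close>

lemma share_zero_CM_quotient_exp:
  assumes hol: "g holomorphic_on UNIV" "h holomorphic_on UNIV"
    and share: "share_zero_CM S" "g \<in> S" "h \<in> S"
  obtains p where "p holomorphic_on UNIV" "\<And>z. g z = exp (p z) * h z"
proof -
  have z: "h z = 0 \<longleftrightarrow> g z = 0" for z
    using share unfolding share_zero_CM_def by blast
  have eq: "zorder h z = zorder g z" for z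
  proof (cases "h z = 0")
    \<comment> \<open>\<open>share_zero_CM\<close> compares orders at common zeros; elsewhere both
      orders are 0.\<close>
    case True
    then show ?thesis using share unfolding share_zero_CM_def by metis
  next
    case False
    then have "zorder h z = 0" "zorder g z = 0"
      using z[of z] hol by (auto intro!: zorder_eq_0I holomorphic_on_imp_analytic_at[OF _ open_UNIV])
    then show ?thesis by simp
  qed
  obtain u where u: "u holomorphic_on UNIV" "\<And>z. u z \<noteq> 0" "\<And>z. g z = u z * h z"
    using holomorphic_zorder_factorization[OF hol(1) open_UNIV connected_UNIV hol(2) z eq] by auto
  obtain p where "p holomorphic_on UNIV" "\<And>z. exp (p z) = u z"
    using holomorphic_logarithm_exists[OF convex_UNIV open_UNIV u(1)] u(2) by (metis UNIV_I)
  then show ?thesis using that u(3) by simp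
qed

section \<open>Linear independence of exponentials\<close>

text \<open>Shifting affects only terms below degree \<open>d\<close>. As \<open>d\<close> is just a
  bound for the degree, \<open>coeff P d\<close> may be 0, which lets two polynomials of different
  degrees be treated at one common \<open>d\<close>.\<close>

lemma poly_shift_lead:
  fixes P :: "complex poly"
  assumes "degree P \<le> d" "d \<ge> 1"
  obtains P' where "degree P' \<le> d - 1" "\<And>z. poly P (z + c) = coeff P d * z ^ d + poly P' z"
proof
  define S where "S = pcompose P [:c, 1:]"
  have dS: "degree S = degree P" by (simp add: S_def degree_pcompose)
  have "coeff S d = coeff P d"
  proof (cases "degree P = d")
    case True
    then show ?thesis using lead_coeff_comp[of "[:c, 1:]" P] dS by (simp add: S_def)
  next
    case False
    then show ?thesis using assms dS by (simp add: coeff_eq_0)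
  qed
  then have 0: "coeff (S - monom (coeff P d) d) i = 0" if "i \<ge> d" for i
    using that assms dS by (cases "i = d") (auto simp: coeff_eq_0)
  show "degree (S - monom (coeff P d) d) \<le> d - 1"
    using 0 assms(2) by (intro degree_le) auto
  show "poly P (z + c) = coeff P d * z ^ d + poly (S - monom (coeff P d) d) z" for z
    by (simp add: S_def poly_pcompose poly_monom add.commute)
qed

lemma exp_poly_shift_lead:
  fixes P :: "complex poly"
  assumes "degree P \<le> d" "d \<ge> 1"
  obtains a where "a \<in> exp_growth (d - 1)" "\<And>z. a z \<noteq> 0"
    "\<And>z. exp (poly P (z + c)) = a z * exp (coeff P d * z ^ d)"
proof -
  obtain P' where P': "degree P' \<le> d - 1" "\<And>z. poly P (z + c) = coeff P d * z ^ d + poly P' z"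
    using poly_shift_lead[OF assms] by blast
  show ?thesis
    by (rule that[of "\<lambda>z. exp (poly P' z)"])
       (use exp_growth_exp_poly[OF P'(1)] in \<open>simp_all add: P'(2) exp_add\<close>)
qed

text \<open>The step of the induction eliminates one exponential: with \<open>G = \<Sum>\<^sub>\<kappa> a\<^sub>\<kappa> exp (\<kappa> z\<^sup>d)\<close>
  equal to \<open>- A exp (\<kappa>\<^sub>0 z\<^sup>d)\<close>, the combination \<open>A G' - (A' + d \<kappa>\<^sub>0 z\<^bsup>d-1\<^esup> A) G\<close> vanishes.\<close>

theorem Borel_independence:
  fixes a :: "complex \<Rightarrow> complex \<Rightarrow> complex"
  assumes "finite K" and d: "d \<ge> 1"
    and "\<And>\<kappa>. \<kappa> \<in> K \<Longrightarrow> a \<kappa> \<in> exp_growth (d - 1)"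
    and "\<And>z. (\<Sum>\<kappa>\<in>K. a \<kappa> z * exp (\<kappa> * z ^ d)) = 0"
  shows "\<kappa> \<in> K \<Longrightarrow> a \<kappa> z = 0"
  using assms(1,3,4)
proof (induction K arbitrary: a \<kappa> z rule: finite_induct)
  case (insert \<kappa>0 K)
  define A where "A = a \<kappa>0"
  have a: "a \<kappa> \<in> exp_growth (d - 1)" if "\<kappa> \<in> insert \<kappa>0 K" for \<kappa> using insert.prems that by blast
  have A: "A \<in> exp_growth (d - 1)" using a by (simp add: A_def)
  have der: "(f has_field_derivative deriv f z) (at z)" if "f \<in> exp_growth (d - 1)" for f z
    using exp_growth_holomorphic[OF that] holomorphic_derivI open_UNIV by blast
  have dexp: "((\<lambda>z. f z * exp (\<kappa> * z ^ d)) has_field_derivative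
      (deriv f z + of_nat d * \<kappa> * z ^ (d - 1) * f z) * exp (\<kappa> * z ^ d)) (at z)"
    if "f \<in> exp_growth (d - 1)" for f \<kappa> z
    by (auto intro!: derivative_eq_intros der[OF that] simp: algebra_simps)
  define G where "G z = (\<Sum>\<kappa>\<in>K. a \<kappa> z * exp (\<kappa> * z ^ d))" for z
  have G: "G z = - (A z * exp (\<kappa>0 * z ^ d))" for z
    using insert.prems(3)[of z] insert.hyps by (simp add: A_def G_def add_eq_0_iff)
  \<comment> \<open>These are the coefficients of the combination that eliminates \<kappa>0. They
    remain of growth \<open>d - 1\<close>, so the induction hypothesis makes all of them
    vanish.\<close>
  define b where "b \<kappa> z = A z * (deriv (a \<kappa>) z + of_nat d * \<kappa> * z ^ (d - 1) * a \<kappa> z)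
      - (deriv A z + of_nat d * \<kappa>0 * z ^ (d - 1) * A z) * a \<kappa> z" for \<kappa> z
  have pw: "(\<lambda>z. w * z ^ (d - 1)) \<in> exp_growth (d - 1)" for w :: complex
    using exp_growth_poly[of "monom w (d - 1)" "d - 1"] degree_monom_le[of w "d - 1"]
    by (simp add: poly_monom[abs_def])
  have bgr: "b \<kappa> \<in> exp_growth (d - 1)" if "\<kappa> \<in> K" for \<kappa>
    unfolding b_def[abs_def] using that
    by (intro exp_growth_diff exp_growth_mult exp_growth_add exp_growth_deriv pw A a) auto
  have bsum: "(\<Sum>\<kappa>\<in>K. b \<kappa> z * exp (\<kappa> * z ^ d)) = 0" for z
  proof -
    define G' where "G' = (\<Sum>\<kappa>\<in>K. (deriv (a \<kappa>) z + of_nat d * \<kappa> * z ^ (d - 1) * a \<kappa> z) * exp (\<kappa> * z ^ d))"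
    define w where "w = deriv A z + of_nat d * \<kappa>0 * z ^ (d - 1) * A z"
    have "(G has_field_derivative G') (at z)"
      unfolding G_def[abs_def] G'_def using a by (intro DERIV_sum dexp) auto
    moreover have "(G has_field_derivative - (w * exp (\<kappa>0 * z ^ d))) (at z)"
      unfolding G[abs_def] w_def by (intro DERIV_minus dexp A)
    ultimately have "G' = - (w * exp (\<kappa>0 * z ^ d))" by (rule DERIV_unique)
    then have "A z * G' - w * G z = 0" by (simp add: G)
    moreover have "(\<Sum>\<kappa>\<in>K. b \<kappa> z * exp (\<kappa> * z ^ d)) = A z * G' - w * G z"
      unfolding G'_def G_def b_def w_def[symmetric] sum_distrib_left sum_subtractf[symmetric]
      by (intro sum.cong) (auto simp: algebra_simps)
    ultimately show ?thesis by simp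
  qed
  have b0: "b \<kappa> z = 0" if "\<kappa> \<in> K" for \<kappa> z
    by (rule insert.IH[OF that bgr bsum])
  have A0: "A z = 0" for z
  proof (rule ccontr)
    assume "A z \<noteq> 0"
    have "a \<kappa> w = 0" if "\<kappa> \<in> K" for \<kappa> w
    proof (rule ccontr)
      assume nz: "a \<kappa> w \<noteq> 0"
      \<comment> \<open>Up to an exponential factor, \<open>b \<kappa>\<close> is the numerator of
        the derivative of \<open>u / A\<close>. Its vanishing makes \<open>u / A\<close> constant
        where \<open>A\<close> is nonzero, and the identity theorem extends u = q A to the
        plane.\<close>
      define u where "u z = a \<kappa> z * exp ((\<kappa> - \<kappa>0) * z ^ d)" for z
      have du: "(u has_field_derivative (deriv (a \<kappa>) x + of_nat d * (\<kappa> - \<kappa>0) * x ^ (d - 1) * a \<kappa> x)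
          * exp ((\<kappa> - \<kappa>0) * x ^ d)) (at x)" for x
        unfolding u_def[abs_def] using a that by (intro dexp) auto
      have contA: "isCont A z" using der[OF A] DERIV_isCont by blast
      then obtain e where e: "e > 0" "\<And>x. x \<in> ball z e \<Longrightarrow> A x \<noteq> 0"
        using continuous_at_avoid[of z A 0] \<open>A z \<noteq> 0\<close> by (auto simp: dist_commute)
      have "((\<lambda>x. u x / A x) has_field_derivative 0) (at x within ball z e)" if "x \<in> ball z e" for x
      proof -
        have "((\<lambda>x. u x / A x) has_field_derivative 0) (at x)"
        proof (rule DERIV_cong[OF DERIV_divide[OF du der[OF A] e(2)[OF that]]])
          have "(deriv (a \<kappa>) x + of_nat d * (\<kappa> - \<kappa>0) * x ^ (d - 1) * a \<kappa> x) * exp ((\<kappa> - \<kappa>0) * x ^ d) * A x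
              - u x * deriv A x = b \<kappa> x * exp ((\<kappa> - \<kappa>0) * x ^ d)"
            by (simp add: u_def b_def algebra_simps)
          then show "((deriv (a \<kappa>) x + of_nat d * (\<kappa> - \<kappa>0) * x ^ (d - 1) * a \<kappa> x) * exp ((\<kappa> - \<kappa>0) * x ^ d) * A x
              - u x * deriv A x) / (A x * A x) = 0"
            using b0[OF \<open>\<kappa> \<in> K\<close>] by simp
        qed
        then show ?thesis by (rule has_field_derivative_at_within)
      qed
      then obtain q where q: "\<And>x. x \<in> ball z e \<Longrightarrow> u x / A x = q"
        using has_field_derivative_zero_constant[of "ball z e" "\<lambda>x. u x / A x"] by auto
      have holA: "A holomorphic_on UNIV" using A exp_growth_holomorphic by blast
      have holu: "u holomorphic_on UNIV"
        unfolding u_def[abs_def] using exp_growth_holomorphic[OF a] that by (intro holomorphic_intros) auto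
      have "u x - q * A x = 0" for x
      proof (rule analytic_continuation[where S = UNIV and U = "ball z e" and \<xi> = z and f = "\<lambda>x. u x - q * A x"])
        show "(\<lambda>x. u x - q * A x) holomorphic_on UNIV" using holA holu by (intro holomorphic_intros)
        show "z islimpt ball z e" using e(1) by (simp add: islimpt_ball)
        show "u x - q * A x = 0" if "x \<in> ball z e" for x
          using q[OF that] e(2)[OF that] by (simp add: field_simps)
      qed auto
      then have eq: "exp ((\<kappa> - \<kappa>0) * x ^ d) * a \<kappa> x = q * A x" for x
        by (simp add: u_def mult.commute)
      have hol\<kappa>: "(\<lambda>x. (\<kappa> - \<kappa>0) * x ^ d) holomorphic_on UNIV" by (intro holomorphic_intros)
      have a\<kappa>: "a \<kappa> \<in> exp_growth (d - 1)" using a that by blast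
      \<comment> \<open>The identity exhibits the exponential of (\<kappa> - \<kappa>0) z^d as a
        multiplier between functions of growth \<open>d - 1\<close>, so its exponent would have
        degree at most \<open>d - 1\<close>, although \<kappa> differs from \<kappa>0.\<close>
      obtain P where P: "degree P \<le> d - 1" "(\<lambda>x. (\<kappa> - \<kappa>0) * x ^ d) = poly P"
        using entire_exponent_poly[OF hol\<kappa> exp_growth_cmult[OF A, of q] a\<kappa> nz eq] by blast
      then have "poly (monom (\<kappa> - \<kappa>0) d) = poly P" by (simp add: poly_monom[abs_def])
      then have "monom (\<kappa> - \<kappa>0) d = P" by (simp add: poly_eq_poly_eq_iff)
      moreover have "\<kappa> \<noteq> \<kappa>0" using that insert.hyps by blast
      ultimately have "degree P = d" by (metis degree_monom_eq right_minus_eq)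
      then show False using P(1) d by simp
    qed
    then have "G z = 0" by (simp add: G_def)
    then show False using G[of z] \<open>A z \<noteq> 0\<close> by simp
  qed
  show ?case
  proof (cases "\<kappa> = \<kappa>0")
    case True
    then show ?thesis using A0 by (simp add: A_def)
  next
    case False
    have "(\<Sum>\<kappa>\<in>K. a \<kappa> z * exp (\<kappa> * z ^ d)) = 0" for z
      using G A0 by (simp add: G_def)
    then show ?thesis using False insert.prems insert.IH[of \<kappa> a z] by blast
  qed
qed auto

section \<open>Exponential sums with prescribed frequencies\<close>

text \<open>Terms may repeat a frequency, so closure properties are plain inductions;
  \<open>exp_span_repr\<close> collects the terms into distinct frequencies when independence is
  applied.\<close>

inductive_set exp_span :: "nat \<Rightarrow> complex set \<Rightarrow> (complex \<Rightarrow> complex) set" for d S where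
  zero: "(\<lambda>z. 0) \<in> exp_span d S"
| step: "G \<in> exp_span d S \<Longrightarrow> a \<in> exp_growth (d - 1) \<Longrightarrow> \<kappa> \<in> S
    \<Longrightarrow> (\<lambda>z. G z + a z * exp (\<kappa> * z ^ d)) \<in> exp_span d S"

lemma exp_span_term: "a \<in> exp_growth (d - 1) \<Longrightarrow> \<kappa> \<in> S \<Longrightarrow> (\<lambda>z. a z * exp (\<kappa> * z ^ d)) \<in> exp_span d S"
  using exp_span.step[OF exp_span.zero] by force

lemma exp_span_mono:
  assumes "G \<in> exp_span d S" "\<And>x. x \<in> S \<Longrightarrow> x \<in> T"
  shows "G \<in> exp_span d T"
  using assms(1) by induction (auto intro: exp_span.intros assms(2))

lemma exp_span_add:
  assumes "G \<in> exp_span d S" "H \<in> exp_span d S"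
  shows "(\<lambda>z. G z + H z) \<in> exp_span d S"
  using assms(2)
proof induction
  case zero
  then show ?case using assms(1) by simp
next
  case (step H a \<kappa>)
  then show ?case using exp_span.step[OF step.IH step.hyps(2,3)] by (simp add: add.assoc)
qed

lemma exp_span_mult_term:
  assumes "G \<in> exp_span d S" "a \<in> exp_growth (d - 1)" "\<And>x. x \<in> S \<Longrightarrow> x + \<kappa> \<in> T"
  shows "(\<lambda>z. G z * (a z * exp (\<kappa> * z ^ d))) \<in> exp_span d T"
  using assms(1)
proof induction
  case zero
  then show ?case using exp_span.zero by simp
next
  case (step G a' \<kappa>')
  have "(\<lambda>z. G z * (a z * exp (\<kappa> * z ^ d)) + (a' z * a z) * exp ((\<kappa>' + \<kappa>) * z ^ d)) \<in> exp_span d T"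
    using step assms by (intro exp_span.step exp_growth_mult) auto
  moreover have "(\<lambda>z. G z * (a z * exp (\<kappa> * z ^ d)) + (a' z * a z) * exp ((\<kappa>' + \<kappa>) * z ^ d))
     = (\<lambda>z. (G z + a' z * exp (\<kappa>' * z ^ d)) * (a z * exp (\<kappa> * z ^ d)))"
    by (auto simp: distrib_right exp_add)
  ultimately show ?case by simp
qed

lemma exp_span_mult:
  assumes "G \<in> exp_span d S" "H \<in> exp_span d S'" "\<And>x y. x \<in> S \<Longrightarrow> y \<in> S' \<Longrightarrow> x + y \<in> T"
  shows "(\<lambda>z. G z * H z) \<in> exp_span d T"
  using assms(2)
proof induction
  case zero
  then show ?case using exp_span.zero by simp
next
  case (step H a \<kappa>)
  have "(\<lambda>z. G z * H z + G z * (a z * exp (\<kappa> * z ^ d))) \<in> exp_span d T"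
    using step assms by (intro exp_span_add exp_span_mult_term[OF assms(1)]) auto
  then show ?case by (simp add: distrib_left)
qed

lemma exp_span_growth_mult:
  assumes "a \<in> exp_growth (d - 1)" "G \<in> exp_span d S"
  shows "(\<lambda>z. a z * G z) \<in> exp_span d S"
  using exp_span_mult_term[OF assms(2,1), of 0 S] by (simp add: mult.commute)

lemma exp_span_diff:
  assumes "G \<in> exp_span d S" "H \<in> exp_span d S"
  shows "(\<lambda>z. G z - H z) \<in> exp_span d S"
  using exp_span_add[OF assms(1) exp_span_growth_mult[OF exp_growth_const[of "-1"] assms(2)]] by simp

text \<open>The exponent \<kappa> (z + c)^d differs from \<kappa> z^d by a polynomial of degree
  below \<open>d\<close>, whose exponential is absorbed into the coefficient. Frequencies are thus
  unchanged.\<close>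

lemma exp_span_shift:
  assumes "G \<in> exp_span d S" "d \<ge> 1"
  shows "(\<lambda>z. G (z + c)) \<in> exp_span d S"
  using assms(1)
proof induction
  case zero
  then show ?case by (rule exp_span.zero)
next
  case (step G a \<kappa>)
  obtain l where l: "l \<in> exp_growth (d - 1)"
     "\<And>z. exp (poly (monom \<kappa> d) (z + c)) = l z * exp (coeff (monom \<kappa> d) d * z ^ d)"
    using exp_poly_shift_lead[of "monom \<kappa> d" d c] assms(2) degree_monom_le by metis
  have "(\<lambda>z. G (z + c) + (a (z + c) * l z) * exp (\<kappa> * z ^ d)) \<in> exp_span d S"
    using step l(1) by (intro exp_span.step exp_growth_mult exp_growth_shift) auto
  then show ?case using l(2) by (simp add: poly_monom mult.assoc)
qed

lemma exp_span_holomorphic: "G \<in> exp_span d S \<Longrightarrow> G holomorphic_on UNIV"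
proof (induction rule: exp_span.induct)
  case (step G a \<kappa>)
  then show ?case using exp_growth_holomorphic by (intro holomorphic_intros) auto
qed auto

lemma exp_span_sum:
  assumes "finite K" "K \<subseteq> S" "\<And>\<kappa>. \<kappa> \<in> K \<Longrightarrow> a \<kappa> \<in> exp_growth (d - 1)"
  shows "(\<lambda>z. \<Sum>\<kappa>\<in>K. a \<kappa> z * exp (\<kappa> * z ^ d)) \<in> exp_span d S"
  using assms
proof (induction K rule: finite_induct)
  case empty
  then show ?case using exp_span.zero by simp
next
  case (insert \<kappa> K)
  then show ?case
    using exp_span.step[of "\<lambda>z. \<Sum>\<kappa>\<in>K. a \<kappa> z * exp (\<kappa> * z ^ d)" d S "a \<kappa>" \<kappa>]
    by (simp add: add.commute)
qed

lemma exp_span_repr: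
  assumes "G \<in> exp_span d S"
  obtains K a where "finite K" "K \<subseteq> S" "\<And>\<kappa>. a \<kappa> \<in> exp_growth (d - 1)"
    "\<And>z. G z = (\<Sum>\<kappa>\<in>K. a \<kappa> z * exp (\<kappa> * z ^ d))"
proof -
  \<comment> \<open>The induction also demands zero coefficients outside \<open>K\<close>, so that a
    term with an old or a new frequency is added by the same update.\<close>
  have "\<exists>K a. finite K \<and> K \<subseteq> S \<and> (\<forall>\<kappa>. a \<kappa> \<in> exp_growth (d - 1)) \<and> (\<forall>\<kappa>. \<kappa> \<notin> K \<longrightarrow> a \<kappa> = (\<lambda>z. 0)) \<and>
    (\<forall>z. G z = (\<Sum>\<kappa>\<in>K. a \<kappa> z * exp (\<kappa> * z ^ d)))"
    using assms
  proof induction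
    case zero
    show ?case by (rule exI[of _ "{}"], rule exI[of _ "\<lambda>_ _. 0"]) auto
  next
    case (step G l \<mu>)
    then obtain K a where Ka: "finite K" "K \<subseteq> S" "\<And>\<kappa>. a \<kappa> \<in> exp_growth (d - 1)"
      "\<And>\<kappa>. \<kappa> \<notin> K \<Longrightarrow> a \<kappa> = (\<lambda>z. 0)" "\<And>z. G z = (\<Sum>\<kappa>\<in>K. a \<kappa> z * exp (\<kappa> * z ^ d))"
      by blast
    define a' where "a' = a(\<mu> := (\<lambda>z. a \<mu> z + l z))"
    have "G z + l z * exp (\<mu> * z ^ d) = (\<Sum>\<kappa>\<in>insert \<mu> K. a' \<kappa> z * exp (\<kappa> * z ^ d))" for z
    proof -
      have "G z = (\<Sum>\<kappa>\<in>insert \<mu> K. a \<kappa> z * exp (\<kappa> * z ^ d))"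
        unfolding Ka(5) using Ka(1,4) by (intro sum.mono_neutral_left) auto
      also have "\<dots> = a \<mu> z * exp (\<mu> * z ^ d) + (\<Sum>\<kappa>\<in>K - {\<mu>}. a \<kappa> z * exp (\<kappa> * z ^ d))"
        using Ka(1) by (simp add: sum.insert_remove)
      also have "(\<Sum>\<kappa>\<in>K - {\<mu>}. a \<kappa> z * exp (\<kappa> * z ^ d)) = (\<Sum>\<kappa>\<in>K - {\<mu>}. a' \<kappa> z * exp (\<kappa> * z ^ d))"
        by (intro sum.cong) (auto simp: a'_def)
      finally show ?thesis
        using Ka(1) by (simp add: sum.insert_remove a'_def distrib_right)
    qed
    moreover have "a' \<kappa> \<in> exp_growth (d - 1)" for \<kappa>
      using Ka(3) step.hyps by (auto simp: a'_def intro!: exp_growth_add)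
    ultimately show ?case using Ka step.hyps
      by (intro exI[of _ "insert \<mu> K"] exI[of _ a']) (auto simp: a'_def)
  qed
  then show ?thesis using that by blast
qed

text \<open>The difference of the two representations is a vanishing sum over distinct frequencies,
  so all coefficients are 0 by Borel's theorem.\<close>

lemma exp_span_disjoint:
  assumes "d \<ge> 1" "G \<in> exp_span d S" "G \<in> exp_span d T" "S \<inter> T = {}"
  shows "G z = 0"
proof -
  obtain K a where K: "finite K" "K \<subseteq> S" "\<And>\<kappa>. a \<kappa> \<in> exp_growth (d - 1)"
    "\<And>z. G z = (\<Sum>\<kappa>\<in>K. a \<kappa> z * exp (\<kappa> * z ^ d))"
    using exp_span_repr[OF assms(2)] by blast
  obtain L b where L: "finite L" "L \<subseteq> T" "\<And>\<kappa>. b \<kappa> \<in> exp_growth (d - 1)"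
    "\<And>z. G z = (\<Sum>\<kappa>\<in>L. b \<kappa> z * exp (\<kappa> * z ^ d))"
    using exp_span_repr[OF assms(3)] by blast
  define e where "e \<kappa> = (if \<kappa> \<in> K then a \<kappa> else (\<lambda>z. (-1) * b \<kappa> z))" for \<kappa>
  have KL: "K \<inter> L = {}" using K(2) L(2) assms(4) by blast
  have "(\<Sum>\<kappa>\<in>K \<union> L. e \<kappa> z * exp (\<kappa> * z ^ d)) = 0" for z
  proof -
    have "(\<Sum>\<kappa>\<in>K \<union> L. e \<kappa> z * exp (\<kappa> * z ^ d)) =
        (\<Sum>\<kappa>\<in>K. e \<kappa> z * exp (\<kappa> * z ^ d)) + (\<Sum>\<kappa>\<in>L. e \<kappa> z * exp (\<kappa> * z ^ d))"
      by (rule sum.union_disjoint[OF K(1) L(1) KL])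
    also have "(\<Sum>\<kappa>\<in>K. e \<kappa> z * exp (\<kappa> * z ^ d)) = G z"
      unfolding K(4) by (intro sum.cong) (auto simp: e_def)
    also have "(\<Sum>\<kappa>\<in>L. e \<kappa> z * exp (\<kappa> * z ^ d)) = - G z"
      unfolding L(4) sum_negf[symmetric] using KL by (intro sum.cong) (auto simp: e_def)
    finally show ?thesis by simp
  qed
  moreover have "e \<kappa> \<in> exp_growth (d - 1)" for \<kappa>
    using K(3) exp_growth_cmult[OF L(3), of "-1"] by (auto simp: e_def)
  ultimately have "e \<kappa> z = 0" if "\<kappa> \<in> K \<union> L" for \<kappa> z
    using Borel_independence[of "K \<union> L" d e \<kappa> z] K(1) L(1) assms(1) that by blast
  then have "a \<kappa> z = 0" if "\<kappa> \<in> K" for \<kappa> z using that by (metis UnI1 e_def)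
  then show ?thesis by (simp add: K(4))
qed

section \<open>Grading by frequencies\<close>

text \<open>The real-linear functional \<open>Re (\<omega> * \<kappa>)\<close> turns the grading by
  complex frequencies into a real-valued degree; \<omega> selects the direction.\<close>

abbreviation span_le :: "nat \<Rightarrow> complex \<Rightarrow> real \<Rightarrow> (complex \<Rightarrow> complex) set" where
  "span_le d \<omega> t \<equiv> exp_span d {\<kappa>. Re (\<omega> * \<kappa>) \<le> t}"

abbreviation span_lt :: "nat \<Rightarrow> complex \<Rightarrow> real \<Rightarrow> (complex \<Rightarrow> complex) set" where
  "span_lt d \<omega> t \<equiv> exp_span d {\<kappa>. Re (\<omega> * \<kappa>) < t}"

text \<open>\<open>G\<close> has degree exactly \<open>t\<close> in the direction \<omega>:
  \<open>A\<close> is its top homogeneous part, required to be nonzero as a function.\<close>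

definition leading :: "nat \<Rightarrow> complex \<Rightarrow> real \<Rightarrow> (complex \<Rightarrow> complex) \<Rightarrow> bool" where
  "leading d \<omega> t G \<longleftrightarrow> (\<exists>A B. A \<in> exp_span d {\<kappa>. Re (\<omega> * \<kappa>) = t} \<and> B \<in> span_lt d \<omega> t \<and>
     (\<exists>z. A z \<noteq> 0) \<and> G = (\<lambda>z. A z + B z))"

lemma span_le_mono: "G \<in> span_le d \<omega> s \<Longrightarrow> s \<le> t \<Longrightarrow> G \<in> span_le d \<omega> t"
  by (erule exp_span_mono) auto

lemma span_le_imp_lt: "G \<in> span_le d \<omega> s \<Longrightarrow> s < t \<Longrightarrow> G \<in> span_lt d \<omega> t"
  by (erule exp_span_mono) auto

lemma span_le_mult: "G \<in> span_le d \<omega> s \<Longrightarrow> H \<in> span_le d \<omega> t \<Longrightarrow> (\<lambda>z. G z * H z) \<in> span_le d \<omega> (s + t)"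
  by (rule exp_span_mult[of G d _ H]) (auto simp: distrib_left)

lemma span_le_growth:
  assumes "a \<in> exp_growth (d - 1)"
  shows "a \<in> span_le d \<omega> 0"
  using exp_span_term[OF assms, of 0 "{\<kappa>. Re (\<omega> * \<kappa>) \<le> 0}"] by simp

lemma leading_imp_le:
  assumes "leading d \<omega> t G"
  shows "G \<in> span_le d \<omega> t"
proof -
  obtain A B where AB: "A \<in> exp_span d {\<kappa>. Re (\<omega> * \<kappa>) = t}" "B \<in> span_lt d \<omega> t" "G = (\<lambda>z. A z + B z)"
    using assms unfolding leading_def by blast
  have "A \<in> span_le d \<omega> t" "B \<in> span_le d \<omega> t"
    by (rule exp_span_mono[OF AB(1)], simp) (rule exp_span_mono[OF AB(2)], simp)
  then show ?thesis unfolding AB(3) by (rule exp_span_add)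
qed

text \<open>Otherwise the top part would also be a sum over strictly lower frequencies, and
  disjointness would annihilate it. This makes the degree well defined.\<close>

lemma leading_not_lt:
  assumes "d \<ge> 1" "leading d \<omega> t G"
  shows "G \<notin> span_lt d \<omega> t"
proof
  assume G: "G \<in> span_lt d \<omega> t"
  obtain A B where AB: "A \<in> exp_span d {\<kappa>. Re (\<omega> * \<kappa>) = t}" "B \<in> span_lt d \<omega> t" "\<exists>z. A z \<noteq> 0" "G = (\<lambda>z. A z + B z)"
    using assms(2) unfolding leading_def by blast
  have "A \<in> span_lt d \<omega> t" using exp_span_diff[OF G AB(2)] by (simp add: AB(4))
  then have "A z = 0" for z by (rule exp_span_disjoint[OF assms(1) AB(1)]) auto
  then show False using AB(3) by blast
qed

lemma leading_le_imp: "d \<ge> 1 \<Longrightarrow> leading d \<omega> t G \<Longrightarrow> G \<in> span_le d \<omega> s \<Longrightarrow> t \<le> s"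
  using leading_not_lt span_le_imp_lt by (metis linorder_not_le)

lemma leading_term:
  assumes "a \<in> exp_growth (d - 1)" "a w \<noteq> 0" "Re (\<omega> * \<kappa>) = t"
  shows "leading d \<omega> t (\<lambda>z. a z * exp (\<kappa> * z ^ d))"
  unfolding leading_def using assms
  by (intro exI[of _ "\<lambda>z. a z * exp (\<kappa> * z ^ d)"] exI[of _ "\<lambda>z. 0"])
     (auto intro!: exp_span_term exp_span.zero)

lemma leading_growth: "a \<in> exp_growth (d - 1) \<Longrightarrow> a w \<noteq> 0 \<Longrightarrow> leading d \<omega> 0 a"
  using leading_term[of a d w \<omega> 0 0] by simp

lemma leading_add_lt:
  assumes "leading d \<omega> t G" "H \<in> span_lt d \<omega> t"
  shows "leading d \<omega> t (\<lambda>z. G z + H z)"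
proof -
  obtain A B where AB: "A \<in> exp_span d {\<kappa>. Re (\<omega> * \<kappa>) = t}" "B \<in> span_lt d \<omega> t" "\<exists>z. A z \<noteq> 0" "G = (\<lambda>z. A z + B z)"
    using assms(1) unfolding leading_def by blast
  show ?thesis unfolding leading_def
    using AB exp_span_add[OF AB(2) assms(2)]
    by (intro exI[of _ A] exI[of _ "\<lambda>z. B z + H z"]) (auto simp: add.assoc)
qed

lemma leading_shift:
  assumes "leading d \<omega> t G" "d \<ge> 1"
  shows "leading d \<omega> t (\<lambda>z. G (z + c))"
proof -
  obtain A B w where AB: "A \<in> exp_span d {\<kappa>. Re (\<omega> * \<kappa>) = t}" "B \<in> span_lt d \<omega> t" "A w \<noteq> 0" "G = (\<lambda>z. A z + B z)"
    using assms(1) unfolding leading_def by blast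
  have "A (w - c + c) \<noteq> 0" using AB(3) by simp
  then show ?thesis unfolding leading_def
    using AB exp_span_shift[OF AB(1) assms(2)] exp_span_shift[OF AB(2) assms(2)]
    by (intro exI[of _ "\<lambda>z. A (z + c)"] exI[of _ "\<lambda>z. B (z + c)"]) blast
qed

text \<open>The top part of a product is the product of the top parts, nonzero because entire
  functions have no zero divisors.\<close>

lemma leading_mult:
  assumes "leading d \<omega> s G" "leading d \<omega> t H"
  shows "leading d \<omega> (s + t) (\<lambda>z. G z * H z)"
proof -
  obtain A B where AB: "A \<in> exp_span d {\<kappa>. Re (\<omega> * \<kappa>) = s}" "B \<in> span_lt d \<omega> s" "\<exists>z. A z \<noteq> 0" "G = (\<lambda>z. A z + B z)"
    using assms(1) unfolding leading_def by blast
  obtain A' B' where AB': "A' \<in> exp_span d {\<kappa>. Re (\<omega> * \<kappa>) = t}" "B' \<in> span_lt d \<omega> t" "\<exists>z. A' z \<noteq> 0" "H = (\<lambda>z. A' z + B' z)"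
    using assms(2) unfolding leading_def by blast
  have 1: "(\<lambda>z. A z * A' z) \<in> exp_span d {\<kappa>. Re (\<omega> * \<kappa>) = s + t}"
    by (rule exp_span_mult[OF AB(1) AB'(1)]) (auto simp: distrib_left)
  have 2: "(\<lambda>z. A z * B' z) \<in> span_lt d \<omega> (s + t)"
    by (rule exp_span_mult[OF AB(1) AB'(2)]) (auto simp: distrib_left)
  have 3: "(\<lambda>z. B z * H z) \<in> span_lt d \<omega> (s + t)"
    by (rule exp_span_mult[OF AB(2) leading_imp_le[OF assms(2)]]) (auto simp: distrib_left)
  have "\<exists>z. A z * A' z \<noteq> 0"
    using entire_mult_eq_0[OF exp_span_holomorphic[OF AB(1)] exp_span_holomorphic[OF AB'(1)]] AB(3) AB'(3)
    by blast
  then show ?thesis unfolding leading_def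
    using 1 exp_span_add[OF 2 3]
    by (intro exI[of _ "\<lambda>z. A z * A' z"] exI[of _ "\<lambda>z. A z * B' z + B z * H z"])
       (auto simp: AB(4) AB'(4) algebra_simps)
qed

lemma leading_exists:
  assumes "d \<ge> 1" "G \<in> exp_span d S" "G w \<noteq> 0"
  obtains t where "leading d \<omega> t G"
proof -
  obtain K a where K: "finite K" "K \<subseteq> S" "\<And>\<kappa>. a \<kappa> \<in> exp_growth (d - 1)"
    "\<And>z. G z = (\<Sum>\<kappa>\<in>K. a \<kappa> z * exp (\<kappa> * z ^ d))"
    using exp_span_repr[OF assms(2)] by blast
  \<comment> \<open>Identically zero coefficients are dropped before the maximum is taken; Borel's
    theorem then keeps the top part from cancelling.\<close>
  define L where "L = {\<kappa> \<in> K. \<exists>z. a \<kappa> z \<noteq> 0}"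
  have finL: "finite L" using K(1) by (simp add: L_def)
  have GL: "G z = (\<Sum>\<kappa>\<in>L. a \<kappa> z * exp (\<kappa> * z ^ d))" for z
    unfolding K(4) using K(1) by (intro sum.mono_neutral_right) (auto simp: L_def)
  have "L \<noteq> {}" using GL[of w] assms(3) by auto
  define t where "t = Max ((\<lambda>\<kappa>. Re (\<omega> * \<kappa>)) ` L)"
  define T where "T = {\<kappa> \<in> L. Re (\<omega> * \<kappa>) = t}"
  have "t \<in> (\<lambda>\<kappa>. Re (\<omega> * \<kappa>)) ` L"
    unfolding t_def using finL \<open>L \<noteq> {}\<close> by (intro Max_in) auto
  then obtain \<mu> where \<mu>: "\<mu> \<in> T" by (auto simp: T_def)
  have le: "Re (\<omega> * \<kappa>) \<le> t" if "\<kappa> \<in> L" for \<kappa>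
    unfolding t_def using finL that by (intro Max_ge) auto
  define A where "A z = (\<Sum>\<kappa>\<in>T. a \<kappa> z * exp (\<kappa> * z ^ d))" for z
  define B where "B z = (\<Sum>\<kappa>\<in>L - T. a \<kappa> z * exp (\<kappa> * z ^ d))" for z
  have finT: "finite T" using finL by (simp add: T_def)
  have "A \<in> exp_span d {\<kappa>. Re (\<omega> * \<kappa>) = t}"
    unfolding A_def[abs_def] using finT K(3) by (intro exp_span_sum) (auto simp: T_def)
  moreover have "B \<in> span_lt d \<omega> t"
    unfolding B_def[abs_def] using finL K(3) le
    by (intro exp_span_sum) (auto simp: T_def order.strict_iff_order)
  moreover have "\<exists>z. A z \<noteq> 0"
  proof (rule ccontr)
    assume "\<not> (\<exists>z. A z \<noteq> 0)"
    then have "a \<mu> z = 0" for z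
      using Borel_independence[OF finT assms(1), of a \<mu> z] K(3) \<mu> by (simp add: A_def)
    then show False using \<mu> by (auto simp: T_def L_def)
  qed
  moreover have "G = (\<lambda>z. A z + B z)"
  proof
    have "T \<subseteq> L" by (auto simp: T_def)
    then show "G z = A z + B z" for z
      unfolding GL A_def B_def using finL by (subst sum.subset_diff[of T L]) (auto simp only: add.commute)
  qed
  ultimately show ?thesis using that unfolding leading_def by blast
qed

text \<open>\<open>val_le d \<omega> b t g\<close> says that \<open>g / b\<close> is a quotient of exponential sums of degree at
  most \<open>t\<close> in the direction \<open>\<omega>\<close>; \<open>val_eq\<close> says that the degree equals \<open>t\<close>.\<close>

definition val_le :: "nat \<Rightarrow> complex \<Rightarrow> (complex \<Rightarrow> complex) \<Rightarrow> real \<Rightarrow> (complex \<Rightarrow> complex) \<Rightarrow> bool" where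
  "val_le d \<omega> b t g \<longleftrightarrow> (\<exists>D N \<delta>. leading d \<omega> \<delta> D \<and> N \<in> span_le d \<omega> (\<delta> + t) \<and> (\<forall>z. D z * g z = N z * b z))"

definition val_eq :: "nat \<Rightarrow> complex \<Rightarrow> (complex \<Rightarrow> complex) \<Rightarrow> real \<Rightarrow> (complex \<Rightarrow> complex) \<Rightarrow> bool" where
  "val_eq d \<omega> b t g \<longleftrightarrow> (\<exists>D N \<delta>. leading d \<omega> \<delta> D \<and> leading d \<omega> (\<delta> + t) N \<and> (\<forall>z. D z * g z = N z * b z))"

lemma val_eq_imp_le: "val_eq d \<omega> b t g \<Longrightarrow> val_le d \<omega> b t g"
  unfolding val_eq_def val_le_def using leading_imp_le by blast

lemma val_le_mono: "val_le d \<omega> b s g \<Longrightarrow> s \<le> t \<Longrightarrow> val_le d \<omega> b t g"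
  unfolding val_le_def using span_le_mono by (meson add_left_mono)

text \<open>Cross-multiplying the two fractions and cancelling \<open>b\<close> gives N D' = D N',
  and the degrees of both sides are compared.\<close>

lemma val_eq_le_imp:
  assumes d: "d \<ge> 1" and b: "b holomorphic_on UNIV" "b w \<noteq> 0"
    and eq: "val_eq d \<omega> b t g" and le: "val_le d \<omega> b s g"
  shows "t \<le> s"
proof -
  obtain D N \<delta> where 1: "leading d \<omega> \<delta> D" "leading d \<omega> (\<delta> + t) N" "\<And>z. D z * g z = N z * b z"
    using eq unfolding val_eq_def by blast
  obtain D' N' \<delta>' where 2: "leading d \<omega> \<delta>' D'" "N' \<in> span_le d \<omega> (\<delta>' + s)" "\<And>z. D' z * g z = N' z * b z"
    using le unfolding val_le_def by blast
  have l: "leading d \<omega> ((\<delta> + t) + \<delta>') (\<lambda>z. N z * D' z)" by (rule leading_mult[OF 1(2) 2(1)])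
  have r: "(\<lambda>z. D z * N' z) \<in> span_le d \<omega> (\<delta> + (\<delta>' + s))"
    by (rule span_le_mult[OF leading_imp_le[OF 1(1)] 2(2)])
  have "b z * (N z * D' z - D z * N' z) = 0" for z
  proof -
    have "(N z * b z) * D' z = D z * (N' z * b z)"
      unfolding 1(3)[symmetric] 2(3)[symmetric] by (simp only: mult_ac)
    then show ?thesis by (simp add: algebra_simps)
  qed
  moreover have "(\<lambda>z. N z * D' z - D z * N' z) holomorphic_on UNIV"
    by (rule holomorphic_on_diff[OF exp_span_holomorphic[OF leading_imp_le[OF l]] exp_span_holomorphic[OF r]])
  ultimately have "N z * D' z - D z * N' z = 0" for z
    using entire_mult_eq_0[OF b(1) _ _ b(2), of "\<lambda>z. N z * D' z - D z * N' z"] by blast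
  then have "(\<lambda>z. N z * D' z) = (\<lambda>z. D z * N' z)" by auto
  then have "(\<delta> + t) + \<delta>' \<le> \<delta> + (\<delta>' + s)" using leading_le_imp[OF d l] r by simp
  then show ?thesis by simp
qed

lemma val_eq_base: "val_eq d \<omega> b 0 b"
  unfolding val_eq_def
  by (rule exI[of _ "\<lambda>z. 1"], rule exI[of _ "\<lambda>z. 1"], rule exI[of _ 0])
     (simp add: leading_growth[where w = 0])

lemma val_le_base: "val_le d \<omega> b 0 b"
  by (rule val_eq_imp_le[OF val_eq_base])

lemma val_le_add:
  assumes "val_le d \<omega> b t g" "val_le d \<omega> b t h"
  shows "val_le d \<omega> b t (\<lambda>z. g z + h z)"
proof -
  obtain D N \<delta> where 1: "leading d \<omega> \<delta> D" "N \<in> span_le d \<omega> (\<delta> + t)" "\<And>z. D z * g z = N z * b z"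
    using assms(1) unfolding val_le_def by blast
  obtain D' N' \<delta>' where 2: "leading d \<omega> \<delta>' D'" "N' \<in> span_le d \<omega> (\<delta>' + t)" "\<And>z. D' z * h z = N' z * b z"
    using assms(2) unfolding val_le_def by blast
  have "(\<lambda>z. N z * D' z) \<in> span_le d \<omega> (\<delta> + \<delta>' + t)" "(\<lambda>z. D z * N' z) \<in> span_le d \<omega> (\<delta> + \<delta>' + t)"
    using span_le_mult[OF 1(2) leading_imp_le[OF 2(1)]] span_le_mult[OF leading_imp_le[OF 1(1)] 2(2)]
    by (auto simp: algebra_simps)
  then have "(\<lambda>z. N z * D' z + D z * N' z) \<in> span_le d \<omega> (\<delta> + \<delta>' + t)" by (rule exp_span_add)
  moreover have "(D z * D' z) * (g z + h z) = (N z * D' z + D z * N' z) * b z" for z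
  proof -
    have "(D z * D' z) * (g z + h z) = (D z * g z) * D' z + D z * (D' z * h z)"
      by (simp add: algebra_simps)
    also have "\<dots> = (N z * D' z + D z * N' z) * b z"
      unfolding 1(3) 2(3) by (simp add: algebra_simps)
    finally show ?thesis .
  qed
  ultimately show ?thesis unfolding val_le_def using leading_mult[OF 1(1) 2(1)] by blast
qed

lemma val_le_mult:
  assumes "X \<in> span_le d \<omega> s" "val_le d \<omega> b t g"
  shows "val_le d \<omega> b (s + t) (\<lambda>z. X z * g z)"
proof -
  obtain D N \<delta> where 1: "leading d \<omega> \<delta> D" "N \<in> span_le d \<omega> (\<delta> + t)" "\<And>z. D z * g z = N z * b z"
    using assms(2) unfolding val_le_def by blast
  have "(\<lambda>z. X z * N z) \<in> span_le d \<omega> (\<delta> + (s + t))"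
    using span_le_mult[OF assms(1) 1(2)] by (simp add: algebra_simps)
  moreover have "D z * (X z * g z) = (X z * N z) * b z" for z
    using 1(3)[of z] by (simp add: algebra_simps)
  ultimately show ?thesis unfolding val_le_def using 1(1) by blast
qed

lemma val_eq_mult:
  assumes "leading d \<omega> s X" "val_eq d \<omega> b t g"
  shows "val_eq d \<omega> b (s + t) (\<lambda>z. X z * g z)"
proof -
  obtain D N \<delta> where 1: "leading d \<omega> \<delta> D" "leading d \<omega> (\<delta> + t) N" "\<And>z. D z * g z = N z * b z"
    using assms(2) unfolding val_eq_def by blast
  have "leading d \<omega> (\<delta> + (s + t)) (\<lambda>z. X z * N z)"
    using leading_mult[OF assms(1) 1(2)] by (simp add: algebra_simps)
  moreover have "D z * (X z * g z) = (X z * N z) * b z" for z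
    using 1(3)[of z] by (simp add: algebra_simps)
  ultimately show ?thesis unfolding val_eq_def using 1(1) by blast
qed

lemma val_le_cmult:
  assumes "val_le d \<omega> b t g"
  shows "val_le d \<omega> b t (\<lambda>z. w * g z)"
  using val_le_mult[OF span_le_growth[OF exp_growth_const] assms, of w] by simp

lemma val_le_diff:
  assumes "val_le d \<omega> b t g" "val_le d \<omega> b t h"
  shows "val_le d \<omega> b t (\<lambda>z. g z - h z)"
  using val_le_add[OF assms(1) val_le_cmult[OF assms(2), of "-1"]] by simp

text \<open>No growth bound of order \<open>d - 1\<close> is available for \<open>b\<close>, so it
  cannot be a coefficient of the grading. Being periodic, it passes through shifts unchanged, which
  is why degrees are measured relative to \<open>b\<close>.\<close>

lemma val_le_shift:
  assumes "d \<ge> 1" "\<And>z. b (z + c) = b z" "val_le d \<omega> b t g"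
  shows "val_le d \<omega> b t (\<lambda>z. g (z + c))"
proof -
  obtain D N \<delta> where 1: "leading d \<omega> \<delta> D" "N \<in> span_le d \<omega> (\<delta> + t)" "\<And>z. D z * g z = N z * b z"
    using assms(3) unfolding val_le_def by blast
  have "D (z + c) * g (z + c) = N (z + c) * b z" for z using 1(3)[of "z + c"] assms(2) by simp
  then show ?thesis unfolding val_le_def
    using leading_shift[OF 1(1) assms(1)] exp_span_shift[OF 1(2) assms(1)] by blast
qed

lemma val_le_fwd_diff_funpow:
  assumes "d \<ge> 1" "\<And>z. b (z + c) = b z" "val_le d \<omega> b t g"
  shows "val_le d \<omega> b t ((fwd_diff c ^^ n) g)"
proof (induction n)
  case (Suc n)
  show ?case using val_le_diff[OF val_le_shift[OF assms(1,2) Suc] Suc] by (simp add: fwd_diff_def)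
qed (use assms in simp)

section \<open>The difference equations\<close>

lemma fwd_diff_exp_growth: "g \<in> exp_growth k \<Longrightarrow> fwd_diff c g \<in> exp_growth k"
  unfolding fwd_diff_def by (intro exp_growth_diff exp_growth_shift)

lemma funpow_fwd_diff_exp_growth: "g \<in> exp_growth k \<Longrightarrow> (fwd_diff c ^^ n) g \<in> exp_growth k"
  by (induction n) (auto intro: fwd_diff_exp_growth)

lemma funpow_fwd_diff_add:
  "(fwd_diff c ^^ n) (\<lambda>z. g z + h z) = (\<lambda>z. (fwd_diff c ^^ n) g z + (fwd_diff c ^^ n) h z)"
  by (induction n) (auto simp: fwd_diff_def)

lemma funpow_fwd_diff_cmult: "(fwd_diff c ^^ n) (\<lambda>z. w * g z) = (\<lambda>z. w * (fwd_diff c ^^ n) g z)"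
  by (induction n) (auto simp: fwd_diff_def algebra_simps)

lemma funpow_fwd_diff_zero: "(fwd_diff c ^^ n) (\<lambda>z. 0) = (\<lambda>z. 0)"
  using funpow_fwd_diff_cmult[of n c 0 "\<lambda>z. 0"] by simp

lemma funpow_fwd_diff_periodic:
  assumes "n \<ge> 1" "periodic_with c a"
  shows "(fwd_diff c ^^ n) a = (\<lambda>z. 0)"
proof -
  obtain m where "n = Suc m" using assms(1) by (cases n) auto
  moreover have "fwd_diff c a = (\<lambda>z. 0)" using assms(2) by (auto simp: fwd_diff_def periodic_with_def)
  ultimately show ?thesis by (simp add: funpow_Suc_right funpow_fwd_diff_zero del: funpow.simps(2))
qed

text \<open>The coefficients of \<open>y\<close> and \<open>b\<close> in the \<open>n\<close>-th difference of \<open>g y\<close>, when \<open>b\<close> is periodic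
  and \<open>y (z + c) = (1 + R z) y z + b z\<close>.\<close>

primrec diff_coeff_y :: "complex \<Rightarrow> (complex \<Rightarrow> complex) \<Rightarrow> (complex \<Rightarrow> complex) \<Rightarrow> nat \<Rightarrow> complex \<Rightarrow> complex" where
  "diff_coeff_y c R g 0 = g"
| "diff_coeff_y c R g (Suc n) = (\<lambda>z. diff_coeff_y c R g n (z + c) * (1 + R z) - diff_coeff_y c R g n z)"

primrec diff_coeff_b :: "complex \<Rightarrow> (complex \<Rightarrow> complex) \<Rightarrow> (complex \<Rightarrow> complex) \<Rightarrow> nat \<Rightarrow> complex \<Rightarrow> complex" where
  "diff_coeff_b c R g 0 = (\<lambda>z. 0)"
| "diff_coeff_b c R g (Suc n) =
     (\<lambda>z. diff_coeff_y c R g n (z + c) + (diff_coeff_b c R g n (z + c) - diff_coeff_b c R g n z))"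

lemma funpow_fwd_diff_eq_diff_coeff:
  assumes "\<And>z. y (z + c) = (1 + R z) * y z + b z" "\<And>z. b (z + c) = b z"
  shows "(fwd_diff c ^^ n) (\<lambda>z. g z * y z) z = diff_coeff_y c R g n z * y z + diff_coeff_b c R g n z * b z"
proof (induction n arbitrary: z)
  case (Suc n)
  then show ?case by (simp add: fwd_diff_def assms) (simp add: algebra_simps)
qed simp

lemma exp_growth_in_span: "a \<in> exp_growth (d - 1) \<Longrightarrow> a \<in> exp_span d UNIV"
  using exp_span_term[of a d 0 UNIV] by simp

lemma leading_exp_poly:
  assumes "degree P \<le> d" "d \<ge> 1"
  shows "leading d \<omega> (Re (\<omega> * coeff P d)) (\<lambda>z. exp (poly P z))"
proof -
  obtain l where l: "l \<in> exp_growth (d - 1)" "\<And>z. l z \<noteq> 0"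
    "\<And>z. exp (poly P (z + 0)) = l z * exp (coeff P d * z ^ d)"
    using exp_poly_shift_lead[OF assms, of 0] by blast
  then show ?thesis using leading_term[OF l(1) l(2)[of 0], of \<omega> "coeff P d"] by simp
qed

section \<open>Degrees of the difference coefficients\<close>

text \<open>Where \<open>R\<close> has degree 1, each difference multiplies the shifted coefficient
  by \<open>1 + R\<close> and raises its degree by one; the subtracted old coefficient has lower
  degree.\<close>

lemma leading_diff_coeff_y:
  assumes d: "d \<ge> 1" and R: "leading d \<omega> 1 R" and g: "leading d \<omega> s g"
  shows "leading d \<omega> (s + real n) (diff_coeff_y c R g n)"
proof (induction n)
  case (Suc n)
  have "(\<lambda>z. 1) \<in> span_lt d \<omega> 1"
    by (rule span_le_imp_lt[OF span_le_growth[OF exp_growth_const]]) simp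
  then have R1: "leading d \<omega> 1 (\<lambda>z. R z + 1)" by (rule leading_add_lt[OF R])
  have "leading d \<omega> (s + real n + 1) (\<lambda>z. diff_coeff_y c R g n (z + c) * (R z + 1))"
    by (rule leading_mult[OF leading_shift[OF Suc d] R1])
  moreover have "(\<lambda>z. (-1) * diff_coeff_y c R g n z) \<in> span_lt d \<omega> (s + real n + 1)"
    by (rule span_le_imp_lt[OF exp_span_growth_mult[OF exp_growth_const leading_imp_le[OF Suc]]]) simp
  ultimately have "leading d \<omega> (s + real n + 1)
      (\<lambda>z. diff_coeff_y c R g n (z + c) * (R z + 1) + (-1) * diff_coeff_y c R g n z)"
    by (rule leading_add_lt)
  then show ?case by (simp add: algebra_simps)
qed (use g in simp)

text \<open>Starting from 0 and receiving the \<open>y\<close>-coefficient of the preceding stage,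
  this coefficient stays one degree behind.\<close>

lemma span_le_diff_coeff_b:
  assumes d: "d \<ge> 1" and R: "leading d \<omega> 1 R" and g: "leading d \<omega> s g"
  shows "diff_coeff_b c R g n \<in> span_le d \<omega> (s + real n - 1)"
proof (induction n)
  case 0
  show ?case by (simp add: exp_span.zero)
next
  case (Suc n)
  have B: "diff_coeff_b c R g n \<in> span_le d \<omega> (s + real n)"
    by (rule span_le_mono[OF Suc]) simp
  have "(\<lambda>z. diff_coeff_y c R g n (z + c)) \<in> span_le d \<omega> (s + real n)"
    by (rule exp_span_shift[OF leading_imp_le[OF leading_diff_coeff_y[OF assms]] d])
  then have "diff_coeff_b c R g (Suc n) \<in> span_le d \<omega> (s + real n)"
    unfolding diff_coeff_b.simps by (rule exp_span_add[OF _ exp_span_diff[OF exp_span_shift[OF B d] B]])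
  then show ?case by simp
qed

lemma span_le_diff_coeff:
  assumes d: "d \<ge> 1" and R: "R \<in> span_le d \<omega> 0" and g: "g \<in> span_le d \<omega> s"
  shows "diff_coeff_y c R g n \<in> span_le d \<omega> s" "diff_coeff_b c R g n \<in> span_le d \<omega> s"
proof -
  have R1: "(\<lambda>z. 1 + R z) \<in> span_le d \<omega> 0"
    by (intro exp_span_add R span_le_growth exp_growth_const)
  show y: "diff_coeff_y c R g n \<in> span_le d \<omega> s" for n
  proof (induction n)
    case (Suc n)
    show ?case
      using exp_span_diff[OF span_le_mult[OF exp_span_shift[OF Suc d] R1] _] Suc by simp
  qed (use g in simp)
  show "diff_coeff_b c R g n \<in> span_le d \<omega> s"
  proof (induction n)
    case (Suc n)
    then show ?case
      unfolding diff_coeff_b.simps by (intro exp_span_add exp_span_diff exp_span_shift y d)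
  qed (simp add: exp_span.zero)
qed

lemma span_diff_coeff:
  assumes d: "d \<ge> 1" and R: "R \<in> exp_span d UNIV" and g: "g \<in> exp_span d UNIV"
  shows "diff_coeff_y c R g n \<in> exp_span d UNIV" "diff_coeff_b c R g n \<in> exp_span d UNIV"
proof -
  have R1: "(\<lambda>z. 1 + R z) \<in> exp_span d UNIV"
    by (intro exp_span_add R exp_growth_in_span exp_growth_const)
  show y: "diff_coeff_y c R g n \<in> exp_span d UNIV" for n
  proof (induction n)
    case (Suc n)
    have "(\<lambda>z. diff_coeff_y c R g n (z + c) * (1 + R z)) \<in> exp_span d UNIV"
      by (rule exp_span_mult[OF exp_span_shift[OF Suc d] R1]) simp
    then show ?case unfolding diff_coeff_y.simps by (rule exp_span_diff[OF _ Suc])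
  qed (use g in simp)
  show "diff_coeff_b c R g n \<in> exp_span d UNIV"
  proof (induction n)
    case (Suc n)
    then show ?case
      unfolding diff_coeff_b.simps by (intro exp_span_add exp_span_diff exp_span_shift y d)
  qed (simp add: exp_span.zero)
qed

section \<open>Contradiction for nonconstant exponents\<close>

text \<open>Here y = e^P F in the notation of the overview. \<open>diff_y\<close> is the first
  equation, \<open>y_shift\<close> combines both, and y + b is \<Delta>^n F, so \<open>K_nz\<close>
  expresses that this difference is not identically zero.\<close>

locale difference_system =
  fixes c :: complex and n d :: nat and P Q :: "complex poly" and y b :: "complex \<Rightarrow> complex"
    and w0 w1 :: complex
  assumes n: "n \<ge> 1" and d: "d \<ge> 1"
    and degP: "degree P \<le> d" and degQ: "degree Q \<le> d"
    and nonconst: "coeff P d \<noteq> 0 \<or> coeff Q d \<noteq> 0"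
    and holy: "y holomorphic_on UNIV" and holb: "b holomorphic_on UNIV"
    and b_per: "b (z + c) = b z" and b_nz: "b w0 \<noteq> 0"
    and K_nz: "y w1 + b w1 \<noteq> 0"
    and y_shift: "y (z + c) = (1 + exp (poly (Q - P) z)) * y z + b z"
    and diff_y: "(fwd_diff c ^^ n) (\<lambda>z. exp (poly (- P) z) * y z) z = y z + b z"
begin

definition R where "R z = exp (poly (Q - P) z)"
definition g where "g z = exp (poly (- P) z)"

abbreviation "r \<equiv> coeff (Q - P) d"
abbreviation "s \<equiv> coeff P d"

lemma leading_R: "leading d \<omega> (Re (\<omega> * r)) R"
  unfolding R_def[abs_def] using degP degQ d by (intro leading_exp_poly degree_diff_le)

lemma leading_g: "leading d \<omega> (- Re (\<omega> * s)) g"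
  using leading_exp_poly[of "- P" d \<omega>] degP d by (simp add: g_def[abs_def])

lemma y_shift': "y (z + c) = (1 + R z) * y z + b z"
  using y_shift by (simp add: R_def)

lemma diff_gy: "(fwd_diff c ^^ n) (\<lambda>z. g z * y z) z = y z + b z"
  using diff_y by (simp add: g_def)

lemma one_span_le: "(\<lambda>z. 1) \<in> span_le d \<omega> t \<Longrightarrow> 0 \<le> t"
  by (rule leading_le_imp[OF d leading_growth[OF exp_growth_const zero_neq_one[symmetric]]])

text \<open>This keeps the equation for \<open>y\<close> in \<open>val_eq_y\<close> nontrivial. If r
  is nonzero, in the direction 1/r the two coefficients have different degrees, so they cannot both
  be 1. If r = 0, in the direction 1/s the \<open>y\<close>-coefficient has degree at most -1, too
  small for the function 1.\<close>

lemma diff_coeff_not_both_1: "\<exists>z. diff_coeff_y c R g n z \<noteq> 1 \<or> diff_coeff_b c R g n z \<noteq> 1"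
proof (rule ccontr)
  assume "\<not> ?thesis"
  then have X: "diff_coeff_y c R g n = (\<lambda>z. 1)" and Y: "diff_coeff_b c R g n = (\<lambda>z. 1)" by auto
  show False
  proof (cases "r = 0")
    case False
    define \<omega> where "\<omega> = 1 / r"
    define \<sigma> where "\<sigma> = Re (\<omega> * s)"
    have R1: "leading d \<omega> 1 R" using leading_R[of \<omega>] False by (simp add: \<omega>_def)
    have g1: "leading d \<omega> (- \<sigma>) g" using leading_g[of \<omega>] by (simp add: \<sigma>_def)
    have "- \<sigma> + real n \<le> 0"
      using leading_le_imp[OF d leading_diff_coeff_y[OF d R1 g1, of n c]] span_le_growth[OF exp_growth_const]
      unfolding X by blast
    moreover have "0 \<le> - \<sigma> + real n - 1"
      using span_le_diff_coeff_b[OF d R1 g1, of c n] one_span_le unfolding Y by blast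
    ultimately show False by linarith
  next
    case True
    then have s: "s \<noteq> 0" using nonconst by auto
    define \<omega> where "\<omega> = 1 / s"
    have "R \<in> span_le d \<omega> 0" using leading_imp_le[OF leading_R[of \<omega>]] True by simp
    moreover have "g \<in> span_le d \<omega> (-1)" using leading_imp_le[OF leading_g[of \<omega>]] s by (simp add: \<omega>_def)
    ultimately have "(0::real) \<le> -1"
      using span_le_diff_coeff(1)[OF d, of R \<omega> g "-1" c n] one_span_le unfolding X by blast
    then show False by simp
  qed
qed

text \<open>\<open>diff_gy\<close> reads D y = N b. If \<open>D\<close> vanished so would
  \<open>N\<close>, which is excluded; if \<open>N\<close> vanished then y = 0, and the shift
  equation would give b = 0.\<close>

lemma val_eq_y: "\<exists>t. val_eq d \<omega> b t y"
proof -
  define D where "D z = diff_coeff_y c R g n z - 1" for z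
  define N where "N z = 1 - diff_coeff_b c R g n z" for z
  have Rs: "R \<in> exp_span d UNIV" and gs: "g \<in> exp_span d UNIV"
    using exp_span_mono[OF leading_imp_le[OF leading_R[of 0]]] exp_span_mono[OF leading_imp_le[OF leading_g[of 0]]]
    by auto
  have Ds: "D \<in> exp_span d UNIV" and Ns: "N \<in> exp_span d UNIV"
    unfolding D_def[abs_def] N_def[abs_def]
    by (intro exp_span_diff span_diff_coeff d Rs gs exp_growth_in_span exp_growth_const)+
  have eq: "D z * y z = N z * b z" for z
    using funpow_fwd_diff_eq_diff_coeff[where y = y and c = c and R = R and b = b and g = g and n = n and z = z]
      diff_gy[of z] y_shift' b_per by (simp add: D_def N_def algebra_simps)
  have holD: "D holomorphic_on UNIV" and holN: "N holomorphic_on UNIV"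
    using exp_span_holomorphic Ds Ns by blast+
  obtain u where u: "D u \<noteq> 0"
  proof (rule ccontr)
    assume *: "\<not> thesis"
    then have D0: "D z = 0" for z using that by blast
    then have "b z * N z = 0" for z using eq[of z] by (simp add: mult.commute)
    then have "N z = 0" for z using entire_mult_eq_0[OF holb holN _ b_nz] by blast
    then show False using diff_coeff_not_both_1 D0 by (auto simp: D_def N_def)
  qed
  obtain v where v: "N v \<noteq> 0"
  proof (rule ccontr)
    assume *: "\<not> thesis"
    then have "D z * y z = 0" for z using eq[of z] that by auto
    then have "y z = 0" for z using entire_mult_eq_0[OF holD holy _ u] by blast
    then show False using y_shift'[of w0] b_nz by simp
  qed
  obtain \<delta> where "leading d \<omega> \<delta> D" using leading_exists[OF d Ds u] by blast
  moreover obtain \<nu> where "leading d \<omega> \<nu> N" using leading_exists[OF d Ns v] by blast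
  then have "leading d \<omega> (\<delta> + (\<nu> - \<delta>)) N" by simp
  ultimately show ?thesis unfolding val_eq_def using eq by blast
qed

text \<open>y + b is the \<open>n\<close>-th difference of g y: the factor \<open>g\<close> lowers
  the degree by Re(\<omega> s), and differences do not raise it.\<close>

lemma val_le_diff_gy:
  assumes "val_le d \<omega> b t y"
  shows "val_le d \<omega> b (t - Re (\<omega> * s)) (\<lambda>z. y z + b z)"
proof -
  have "val_le d \<omega> b (- Re (\<omega> * s) + t) ((fwd_diff c ^^ n) (\<lambda>z. g z * y z))"
    by (intro val_le_fwd_diff_funpow d b_per val_le_mult leading_imp_le leading_g assms)
  moreover have "(fwd_diff c ^^ n) (\<lambda>z. g z * y z) = (\<lambda>z. y z + b z)"
    using diff_gy by blast
  ultimately show ?thesis by (simp add: algebra_simps)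
qed

lemma val_eq_le: "val_eq d \<omega> b t h \<Longrightarrow> val_le d \<omega> b t' h \<Longrightarrow> t \<le> t'"
  by (rule val_eq_le_imp[OF d holb b_nz])

lemma val_le_b: "val_le d \<omega> b t b \<Longrightarrow> 0 \<le> t"
  by (rule val_eq_le[OF val_eq_base])

text \<open>From y = (y + b) - b the degree t of \<open>y\<close> satisfies t \<le> max (t -
  \<sigma>) 0 with \<sigma> > 0.\<close>

lemma val_le_y_nonpos:
  assumes "Re (\<omega> * s) > 0"
  shows "val_le d \<omega> b 0 y"
proof -
  obtain t where t: "val_eq d \<omega> b t y" using val_eq_y by blast
  define \<sigma> where "\<sigma> = Re (\<omega> * s)"
  have "val_le d \<omega> b (max (t - \<sigma>) 0) (\<lambda>z. (y z + b z) - b z)"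
    by (intro val_le_diff val_le_mono[OF val_le_diff_gy[OF val_eq_imp_le[OF t]]] val_le_mono[OF val_le_base])
       (auto simp: \<sigma>_def)
  then have "t \<le> max (t - \<sigma>) 0" using val_eq_le[OF t] by simp
  then have "t \<le> 0" using assms by (simp add: \<sigma>_def max_def split: if_splits)
  then show ?thesis using val_le_mono[OF val_eq_imp_le[OF t]] by blast
qed

text \<open>If \<open>y\<close> has degree t, then R y = \<Delta> y - b has degree t + 1 but at most
  max t 0, so t \<le> -1. Then \<open>b\<close>, of degree 0, equals (y + b) - y, which forces t -
  Re(\<omega> s) \<ge> 0.\<close>

lemma Re_s_le_if_Re_r_eq_1:
  assumes "Re (\<omega> * r) = 1"
  shows "Re (\<omega> * s) \<le> -1"
proof -
  obtain t where t: "val_eq d \<omega> b t y" using val_eq_y by blast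
  have le: "val_le d \<omega> b t y" by (rule val_eq_imp_le[OF t])
  have "val_le d \<omega> b (max t 0) (\<lambda>z. (y (z + c) - y z) - b z)"
    by (intro val_le_diff val_le_shift d b_per val_le_mono[OF le] val_le_mono[OF val_le_base]) auto
  moreover have "(\<lambda>z. (y (z + c) - y z) - b z) = (\<lambda>z. R z * y z)"
    by (simp add: y_shift' algebra_simps)
  moreover have "val_eq d \<omega> b (1 + t) (\<lambda>z. R z * y z)"
    using leading_R[of \<omega>] assms by (intro val_eq_mult t) simp
  ultimately have "1 + t \<le> max t 0" using val_eq_le by metis
  then have t1: "t \<le> -1" by (simp add: max_def split: if_splits)
  define m where "m = max (t - Re (\<omega> * s)) t"
  have "val_le d \<omega> b m (\<lambda>z. (y z + b z) - y z)"
    by (intro val_le_diff val_le_mono[OF val_le_diff_gy[OF le]] val_le_mono[OF le]) (auto simp: m_def)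
  then have "0 \<le> m" using val_le_b by simp
  then show ?thesis using t1 by (simp add: m_def max_def split: if_splits)
qed

text \<open>The preceding bound in the direction 1/r gives Re(\<omega> s) \<ge> 1 in the opposite
  direction, where \<open>R\<close> has degree -1. There y + b and R y have degree at most -1, yet
  with K = y + b one has b = K(z + c) - K(z) - R y.\<close>

lemma r_eq_0: "r = 0"
proof (rule ccontr)
  assume r: "r \<noteq> 0"
  define \<omega> where "\<omega> = - (1 / r)"
  have "Re (1 / r * s) \<le> -1" using r by (intro Re_s_le_if_Re_r_eq_1) simp
  then have s1: "Re (\<omega> * s) \<ge> 1" by (simp add: \<omega>_def)
  have R1: "R \<in> span_le d \<omega> (-1)" using leading_imp_le[OF leading_R[of \<omega>]] r by (simp add: \<omega>_def)
  have y0: "val_le d \<omega> b 0 y" by (rule val_le_y_nonpos) (use s1 in linarith)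
  have K: "val_le d \<omega> b (-1) (\<lambda>z. y z + b z)"
    by (rule val_le_mono[OF val_le_diff_gy[OF y0]]) (use s1 in linarith)
  have "val_le d \<omega> b (-1 + 0) (\<lambda>z. R z * y z)" by (rule val_le_mult[OF R1 y0])
  then have "val_le d \<omega> b (-1) (\<lambda>z. (y (z + c) + b (z + c)) - (y z + b z) - R z * y z)"
    using val_le_shift[OF d b_per K] by (intro val_le_diff K) simp_all
  moreover have "(\<lambda>z. (y (z + c) + b (z + c)) - (y z + b z) - R z * y z) = b"
    by (auto simp: y_shift' b_per algebra_simps)
  ultimately show False using val_le_b[of \<omega> "-1"] by simp
qed

lemma inconsistent: False
proof -
  have s: "s \<noteq> 0" using nonconst r_eq_0 by auto
  define \<omega> where "\<omega> = 1 / s"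
  have s1: "Re (\<omega> * s) = 1" using s by (simp add: \<omega>_def)
  have y0: "val_le d \<omega> b 0 y" using s1 by (intro val_le_y_nonpos) linarith
  define K where "K z = y z + b z" for z
  have K: "val_le d \<omega> b (-1) K"
    using val_le_diff_gy[OF y0] unfolding s1 K_def[abs_def] by simp
  have holK: "K holomorphic_on UNIV" unfolding K_def[abs_def] using holy holb by (intro holomorphic_intros)
  \<comment> \<open>With r = 0, \<open>R\<close> becomes a coefficient of the grading instead of a
    term of nonzero frequency.\<close>
  have "coeff (Q - P) i = 0" if "i > d - 1" for i
    using that r_eq_0 degP degQ d by (cases "i = d") (auto simp: coeff_eq_0)
  then have "degree (Q - P) \<le> d - 1" by (intro degree_le) blast
  then have Rgr: "R \<in> exp_growth (d - 1)"
    unfolding R_def[abs_def] by (rule exp_growth_exp_poly)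
  \<comment> \<open>Since K(z + c) = (1 + R) K + (1 - R) b and \<open>K\<close> has degree at most
    -1, so does (1 - R) b; its degree would be 0 unless R = 1.\<close>
  have R1: "R z = 1" for z
  proof (rule ccontr)
    assume nz: "R z \<noteq> 1"
    have gr: "(\<lambda>z. 1 - R z) \<in> exp_growth (d - 1)" by (intro exp_growth_diff Rgr exp_growth_const)
    have "val_eq d \<omega> b (0 + 0) (\<lambda>z. (1 - R z) * b z)"
      using nz by (intro val_eq_mult val_eq_base leading_growth[OF gr, of z]) simp
    moreover have "val_le d \<omega> b (0 + -1) (\<lambda>z. (1 + R z) * K z)"
      by (intro val_le_mult K span_le_growth exp_growth_add Rgr exp_growth_const)
    then have "val_le d \<omega> b (-1) (\<lambda>z. K (z + c) - (1 + R z) * K z)"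
      by (intro val_le_diff val_le_shift d b_per K) simp
    moreover have "(\<lambda>z. K (z + c) - (1 + R z) * K z) = (\<lambda>z. (1 - R z) * b z)"
      by (auto simp: K_def y_shift' b_per algebra_simps)
    ultimately have "(0::real) \<le> -1" using val_eq_le by (metis add_0)
    then show False by simp
  qed
  have K2: "K (z + c) = 2 * K z" for z by (simp add: K_def y_shift' b_per R1 distrib_left)
  \<comment> \<open>As \<open>K\<close> doubles under the shift, a difference of h K is (T h) K;
    \<open>T\<close> commutes with differences.\<close>
  define T :: "(complex \<Rightarrow> complex) \<Rightarrow> complex \<Rightarrow> complex" where "T h = (\<lambda>z. 2 * h (z + c) - h z)" for h
  have DT: "(fwd_diff c ^^ m) (\<lambda>z. h z * K z) = (\<lambda>z. (T ^^ m) h z * K z)" for m h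
    by (induction m) (auto simp: fwd_diff_def T_def K2 algebra_simps)
  have comm: "(T ^^ m) (fwd_diff c h) = fwd_diff c ((T ^^ m) h)" for m h
    by (induction m) (auto simp: fwd_diff_def T_def algebra_simps)
  have comm2: "(T ^^ m) ((fwd_diff c ^^ k) h) = (fwd_diff c ^^ k) ((T ^^ m) h)" for m k h
    by (induction k) (auto simp: comm)
  define W where "W = (fwd_diff c ^^ n) g"
  define S where "S = (T ^^ n) g"
  \<comment> \<open>K is the \<open>n\<close>-th difference of g y = g K - g b. On the first product
    differences act as \<open>T\<close> on \<open>g\<close>, on the second as differences of
    \<open>g\<close>, since \<open>b\<close> is periodic.\<close>
  have K_eq: "K z = S z * K z - W z * b z" for z
  proof -
    have gb: "(fwd_diff c ^^ m) (\<lambda>z. g z * b z) = (\<lambda>z. (fwd_diff c ^^ m) g z * b z)" for m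
      by (induction m) (auto simp: fwd_diff_def b_per algebra_simps)
    have "S z * K z = (fwd_diff c ^^ n) (\<lambda>z. g z * K z) z" by (simp add: DT S_def)
    also have "(\<lambda>z. g z * K z) = (\<lambda>z. g z * y z + g z * b z)" by (simp add: K_def distrib_left)
    also have "(fwd_diff c ^^ n) \<dots> z = K z + W z * b z"
      unfolding funpow_fwd_diff_add gb diff_gy W_def K_def ..
    finally show ?thesis by simp
  qed
  have g1: "g \<in> span_le d \<omega> (-1)" using leading_imp_le[OF leading_g[of \<omega>]] unfolding s1 .
  have S1: "S \<in> span_le d \<omega> (-1)"
  proof -
    have "(T ^^ m) g \<in> span_le d \<omega> (-1)" for m
    proof (induction m)
      case (Suc m)
      have "T ((T ^^ m) g) \<in> span_le d \<omega> (-1)"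
        unfolding T_def[of "(T ^^ m) g"]
        by (intro exp_span_diff exp_span_growth_mult exp_span_shift exp_growth_const Suc d)
      then show ?case by simp
    qed (use g1 in simp)
    then show ?thesis by (simp add: S_def)
  qed
  have W_shift: "W (z + c) = 2 * W z" for z
  proof -
    \<comment> \<open>Subtracting twice \<open>K_eq\<close> from its shift cancels the isolated
      \<open>K\<close> terms.\<close>
    have key: "b z * (W (z + c) - 2 * W z) = 2 * ((S (z + c) - S z) * K z)" for z
    proof -
      have "W (z + c) * b z = S (z + c) * (2 * K z) - 2 * K z"
        using K_eq[of "z + c"] unfolding K2 b_per by algebra
      moreover have "W z * b z = S z * K z - K z" using K_eq[of z] by algebra
      ultimately show ?thesis by algebra
    qed
    obtain l where l: "l \<in> exp_growth (d - 1)" "\<And>z. W (z + c) - 2 * W z = l z * exp (- s * z ^ d)"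
    proof -
      \<comment> \<open>All shifts of differences of \<open>g\<close> carry the single frequency -s.
        The shift \<open>w\<close> is generalised because the induction passes from \<open>w\<close>
        to \<open>w + c\<close>.\<close>
      have ex: "\<exists>l\<in>exp_growth (d - 1). \<forall>z. (fwd_diff c ^^ m) g (z + w) = l z * exp (- s * z ^ d)" for m w
      proof (induction m arbitrary: w)
        case 0
        have "degree (- P) \<le> d" using degP by simp
        then obtain l where "l \<in> exp_growth (d - 1)" "\<And>z. exp (poly (- P) (z + w)) = l z * exp (coeff (- P) d * z ^ d)"
          by (rule exp_poly_shift_lead[OF _ d, of "- P" w]) metis
        then show ?case by (auto simp: g_def)
      next
        case (Suc m)
        obtain l1 l2 where l12: "l1 \<in> exp_growth (d - 1)" "\<And>z. (fwd_diff c ^^ m) g (z + (w + c)) = l1 z * exp (- s * z ^ d)"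
          "l2 \<in> exp_growth (d - 1)" "\<And>z. (fwd_diff c ^^ m) g (z + w) = l2 z * exp (- s * z ^ d)"
          using Suc by metis
        have "(fwd_diff c ^^ Suc m) g (z + w) = (l1 z - l2 z) * exp (- s * z ^ d)" for z
          unfolding left_diff_distrib l12(2,4)[symmetric]
          by (simp add: fwd_diff_def[of c "(fwd_diff c ^^ m) g"] add.assoc)
        then show ?case
          by (intro bexI[of _ "\<lambda>z. l1 z - l2 z"] exp_growth_diff l12(1,3)) blast
      qed
      obtain l1 l2 where l12: "l1 \<in> exp_growth (d - 1)" "\<And>z. W (z + c) = l1 z * exp (- s * z ^ d)"
          "l2 \<in> exp_growth (d - 1)" "\<And>z. W (z + 0) = l2 z * exp (- s * z ^ d)"
        using ex[of n c] ex[of n 0] unfolding W_def by blast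
      show ?thesis
      proof (rule that)
        show "(\<lambda>z. l1 z - 2 * l2 z) \<in> exp_growth (d - 1)"
          by (intro exp_growth_diff exp_growth_cmult l12(1,3))
        show "W (z + c) - 2 * W z = (l1 z - 2 * l2 z) * exp (- s * z ^ d)" for z
          using l12(2)[of z] l12(4)[of z] by (simp add: left_diff_distrib)
      qed
    qed
    \<comment> \<open>In \<open>key\<close> the left side has degree exactly -1 unless
      \<open>l\<close> vanishes, while on the right \<open>S\<close> and \<open>K\<close> contribute
      at most -1 each.\<close>
    have "l z = 0" for z
    proof (rule ccontr)
      assume "l z \<noteq> 0"
      then have "leading d \<omega> (-1) (\<lambda>z. l z * exp (- s * z ^ d))"
        using s1 by (intro leading_term[OF l(1)]) auto
      then have "val_eq d \<omega> b (-1 + 0) (\<lambda>z. (l z * exp (- s * z ^ d)) * b z)"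
        by (rule val_eq_mult[OF _ val_eq_base])
      moreover have "val_le d \<omega> b (-1 + -1) (\<lambda>z. (S (z + c) - S z) * K z)"
        by (intro val_le_mult K exp_span_diff exp_span_shift S1 d)
      then have "val_le d \<omega> b (-2) (\<lambda>z. 2 * ((S (z + c) - S z) * K z))"
        by (intro val_le_cmult) simp
      moreover have "(\<lambda>z. 2 * ((S (z + c) - S z) * K z)) = (\<lambda>z. (l z * exp (- s * z ^ d)) * b z)"
        using key l(2) by (auto simp: fun_eq_iff mult.commute)
      ultimately have "(-1::real) \<le> -2" using val_eq_le by (metis add_0_right)
      then show False by simp
    qed
    then show ?thesis using l(2)[of z] by simp
  qed
  have S_shift: "S (z + c) = S z" for z
  proof -
    have "K z * (S (z + c) - S z) = 0" for z
    proof -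
      have "2 * (K z * (S (z + c) - S z)) = 0"
        using K_eq[of "z + c"] K_eq[of z] unfolding K2 b_per W_shift by algebra
      then show ?thesis by simp
    qed
    moreover have "(\<lambda>z. S (z + c) - S z) holomorphic_on UNIV"
      using exp_span_holomorphic[OF exp_span_diff[OF exp_span_shift[OF S1 d] S1]] .
    ultimately have "S (z + c) - S z = 0"
      using entire_mult_eq_0[OF holK _ _ K_nz[folded K_def], of "\<lambda>z. S (z + c) - S z" z] by blast
    then show ?thesis by simp
  qed
  \<comment> \<open>Doubling makes \<open>T\<close> multiply \<open>W\<close> by 2 * 2 - 1 = 3. By
    commutation T^n W is also the \<open>n\<close>-th difference of the periodic \<open>S\<close>,
    hence 0.\<close>
  have "W z = 0" for z
  proof -
    have "(T ^^ m) W = (\<lambda>z. 3 ^ m * W z)" for m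
      by (induction m) (auto simp: T_def W_shift)
    moreover have "(T ^^ n) W = (fwd_diff c ^^ n) S" by (simp add: W_def S_def comm2)
    moreover have "(fwd_diff c ^^ n) S = (\<lambda>z. 0)"
      using funpow_fwd_diff_periodic[OF n] S_shift by (simp add: periodic_with_def)
    ultimately have "3 ^ n * W z = 0" by metis
    then show ?thesis by simp
  qed
  then have "K z * (S z - 1) = 0" for z using K_eq[of z] by (simp add: algebra_simps)
  moreover have "(\<lambda>z. S z - 1) holomorphic_on UNIV"
    using exp_span_holomorphic[OF S1] by (intro holomorphic_intros)
  ultimately have "S z - 1 = 0" for z
    using entire_mult_eq_0[OF holK _ _ K_nz[folded K_def], of "\<lambda>z. S z - 1" z] by blast
  \<comment> \<open>The function 1 has degree 0, whereas \<open>S\<close> has degree at most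
    -1.\<close>
  then have "S = (\<lambda>z. 1)" by auto
  then show False using one_span_le[of \<omega> "-1"] S1 by simp
qed

end

section \<open>Constant exponents and the conclusion\<close>

lemma constant_multipliers_eq_1:
  assumes n: "n \<ge> 1" and nz: "\<alpha> \<noteq> 0" "\<beta> \<noteq> 0"
    and b: "periodic_with c b" "b w0 \<noteq> 0"
    and G: "\<And>z. (fwd_diff c ^^ n) F z = \<alpha> * F z + b z" "(fwd_diff c ^^ n) F w1 \<noteq> 0"
    and H: "\<And>z. (fwd_diff c ^^ Suc n) F z = \<beta> * F z + b z"
  shows "\<alpha> = 1" "\<beta> = 1"
proof -
  have bper: "b (z + c) = b z" for z using b(1) by (simp add: periodic_with_def)
  define \<rho> where "\<rho> = \<beta> / \<alpha>"
  \<comment> \<open>The correction b / \<beta> makes \<open>L\<close> an eigenfunction of the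
    difference operator with eigenvalue \<rho>: applying it to the first equation gives \<alpha>
    \<Delta> F = \<beta> F + b.\<close>
  define L where "L = (\<lambda>z. F z + 1 / \<beta> * b z)"
  have dL: "fwd_diff c L z = \<rho> * L z" for z
  proof -
    have "\<alpha> * (F (z + c) - F z) = \<beta> * F z + b z"
      using H[of z] by (simp add: fwd_diff_def G(1) bper algebra_simps)
    then have "F (z + c) - F z = (\<beta> * F z + b z) / \<alpha>" using nz by (simp add: nonzero_eq_divide_eq mult.commute)
    moreover have "\<rho> * L z = (\<beta> * F z + b z) / \<alpha>" using nz by (simp add: L_def \<rho>_def field_simps)
    ultimately show ?thesis by (simp add: L_def fwd_diff_def bper)
  qed
  have dLm: "(fwd_diff c ^^ m) L = (\<lambda>z. \<rho> ^ m * L z)" for m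
  proof (induction m)
    case (Suc m)
    have "fwd_diff c (\<lambda>z. \<rho> ^ m * L z) z = \<rho> ^ m * fwd_diff c L z" for z
      by (simp add: fwd_diff_def algebra_simps)
    then show ?case by (intro ext) (simp add: Suc dL)
  qed auto
  have Lz: "\<rho> ^ n * L z = \<alpha> * F z + b z" for z
  proof -
    have "(fwd_diff c ^^ n) L z = (fwd_diff c ^^ n) F z + 1 / \<beta> * (fwd_diff c ^^ n) b z"
      unfolding L_def funpow_fwd_diff_add funpow_fwd_diff_cmult ..
    then show ?thesis using dLm[of n] G(1)[of z] funpow_fwd_diff_periodic[OF n b(1)] by simp
  qed
  have w1: "L w1 \<noteq> 0" using Lz[of w1] G by auto
  have "\<rho> ^ n * L z = \<alpha> * L z + (1 - \<alpha> / \<beta>) * b z" for z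
    using Lz[of z] nz by (simp add: L_def field_simps)
  note eq = this
  \<comment> \<open>One more difference removes the periodic \<open>b\<close> from \<open>eq\<close>
    and leaves \<rho>^n = \<alpha>; evaluating \<open>eq\<close> at \<open>w0\<close> then gives
    \<alpha> = \<beta>, so \<rho> = 1.\<close>
  have "\<rho> ^ n * (L (w1 + c) - L w1) = \<alpha> * (L (w1 + c) - L w1)"
    using eq[of "w1 + c"] eq[of w1] by (simp add: right_diff_distrib bper)
  moreover have "L (w1 + c) - L w1 = \<rho> * L w1" using dL[of w1] by (simp add: fwd_diff_def)
  ultimately have "\<rho> ^ n * (\<rho> * L w1) = \<alpha> * (\<rho> * L w1)" by simp
  moreover have "\<rho> \<noteq> 0" using nz by (simp add: \<rho>_def)
  ultimately have \<rho>\<alpha>: "\<rho> ^ n = \<alpha>" using w1 by simp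
  then have "(1 - \<alpha> / \<beta>) * b w0 = 0" using eq[of w0] by simp
  then have "\<alpha> = \<beta>" using b(2) nz by (simp add: field_simps)
  then have "\<rho> = 1" using nz by (simp add: \<rho>_def)
  then show "\<alpha> = 1" "\<beta> = 1" using \<rho>\<alpha> \<open>\<alpha> = \<beta>\<close> by auto
qed

theorem corollary1p1:
  fixes c :: complex and n :: nat and f a b :: "complex \<Rightarrow> complex"
  assumes "n \<ge> 1"
    and "f holomorphic_on UNIV" and "\<not> f constant_on UNIV" and "finite_order f"
    and "\<exists>z. (fwd_diff c ^^ n) f z \<noteq> 0"
    and "a holomorphic_on UNIV" and "a \<in> small_functions f" and "periodic_with c a"
    and "b holomorphic_on UNIV" and "b \<in> small_functions f" and "periodic_with c b"
    and "\<exists>z. b z \<noteq> 0"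
    and "share_zero_CM {\<lambda>z. f z - a z,
                        \<lambda>z. (fwd_diff c ^^ n) f z - b z,
                        \<lambda>z. (fwd_diff c ^^ (n + 1)) f z - b z}"
  shows "\<forall>z. fwd_diff c f z = f z + b z - a z"
proof -
  have bper: "b (z + c) = b z" and aper: "a (z + c) = a z" for z
    using assms(8,11) by (simp_all add: periodic_with_def)
  obtain w0 where w0: "b w0 \<noteq> 0" using assms(12) by blast
  obtain w1 where w1: "(fwd_diff c ^^ n) f w1 \<noteq> 0" using assms(5) by blast
  obtain k R0 where prox: "\<And>r. r \<ge> R0 \<Longrightarrow> proximity r f \<le> r ^ k"
    using finite_order_proximity_le[OF assms(2,4)] by blast
  have fgr: "f \<in> exp_growth k"
    by (rule exp_growth_if_proximity_le[OF assms(2), of 1 R0]) (use prox in auto)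
  have agr: "a \<in> exp_growth k" and bgr: "b \<in> exp_growth k"
    using small_function_exp_growth[OF assms(2) prox] assms(6,7,9,10) by blast+
  define F where "F = (\<lambda>z. f z - a z)"
  have Fgr: "F \<in> exp_growth k" unfolding F_def by (intro exp_growth_diff fgr agr)
  have diffF: "(fwd_diff c ^^ m) F = (fwd_diff c ^^ m) f" if "m \<ge> 1" for m
  proof -
    have "(fwd_diff c ^^ m) (\<lambda>z. f z + (-1) * a z) = (\<lambda>z. (fwd_diff c ^^ m) f z + (-1) * (fwd_diff c ^^ m) a z)"
      unfolding funpow_fwd_diff_add funpow_fwd_diff_cmult ..
    then show ?thesis by (simp add: F_def funpow_fwd_diff_periodic[OF that assms(8)])
  qed
  define S where "S = {\<lambda>z. f z - a z, \<lambda>z. (fwd_diff c ^^ n) f z - b z, \<lambda>z. (fwd_diff c ^^ (n + 1)) f z - b z}"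
  have share: "share_zero_CM S" using assms(13) by (simp add: S_def)
  have Ggr: "(\<lambda>z. (fwd_diff c ^^ m) f z - b z) \<in> exp_growth k" for m
    by (intro exp_growth_diff funpow_fwd_diff_exp_growth fgr bgr)
  have FS: "F \<in> S" by (simp add: S_def F_def)
  obtain p where p: "p holomorphic_on UNIV" "\<And>z. (fwd_diff c ^^ n) f z - b z = exp (p z) * F z"
    using share_zero_CM_quotient_exp[OF exp_growth_holomorphic[OF Ggr] exp_growth_holomorphic[OF Fgr] share _ FS, of n]
    by (auto simp: S_def)
  obtain q where q: "q holomorphic_on UNIV" "\<And>z. (fwd_diff c ^^ (n + 1)) f z - b z = exp (q z) * F z"
    using share_zero_CM_quotient_exp[OF exp_growth_holomorphic[OF Ggr] exp_growth_holomorphic[OF Fgr] share _ FS, of "n + 1"]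
    by (auto simp: S_def)
  have DF: "(fwd_diff c ^^ n) F z = exp (p z) * F z + b z" for z
    using p(2)[of z] diffF[OF assms(1)] by (simp add: algebra_simps)
  have DF': "(fwd_diff c ^^ Suc n) F z = exp (q z) * F z + b z" for z
    using q(2)[of z] diffF[of "n + 1"] by (simp add: algebra_simps)
  have DF_Suc: "(fwd_diff c ^^ Suc n) F z = exp (p (z + c)) * F (z + c) - exp (p z) * F z" for z
    by (simp add: fwd_diff_def DF bper)
  \<comment> \<open>If F = 0, then \<open>DF'\<close> makes the difference of order n + 1 equal to
    \<open>b\<close>, while \<open>DF_Suc\<close> makes it 0.\<close>
  have "\<exists>z. F z \<noteq> 0"
  proof (rule ccontr)
    assume "\<nexists>z. F z \<noteq> 0"
    then show False using DF'[of w0] DF_Suc[of w0] w0 by simp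
  qed
  then obtain w2 where w2: "F w2 \<noteq> 0" by blast
  obtain P where P: "p = poly P"
    using entire_exponent_poly[OF p(1) Ggr Fgr w2 p(2)[symmetric]] by blast
  obtain Q where Q: "q = poly Q"
    using entire_exponent_poly[OF q(1) Ggr Fgr w2 q(2)[symmetric]] by blast
  define d where "d = max (degree P) (degree Q)"
  have d0: "d = 0"
  proof (rule ccontr)
    assume "d \<noteq> 0"
    then have "P \<noteq> 0 \<and> degree P = d \<or> Q \<noteq> 0 \<and> degree Q = d" by (auto simp: d_def max_def)
    then have lead: "coeff P d \<noteq> 0 \<or> coeff Q d \<noteq> 0" using leading_coeff_0_iff by metis
    have "difference_system c n d P Q (\<lambda>z. exp (p z) * F z) b w0 w1"
    proof
      show "(\<lambda>z. exp (p z) * F z) holomorphic_on UNIV"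
        using p(1) exp_growth_holomorphic[OF Fgr] by (intro holomorphic_intros)
      show "exp (p w1) * F w1 + b w1 \<noteq> 0" using w1 DF[of w1] diffF[OF assms(1)] by simp
      show "exp (p (z + c)) * F (z + c) = (1 + exp (poly (Q - P) z)) * (exp (p z) * F z) + b z" for z
      proof -
        have "exp (poly (Q - P) z) * exp (p z) = exp (q z)"
          by (simp add: P Q flip: exp_add)
        then have X: "(1 + exp (poly (Q - P) z)) * (exp (p z) * F z) = exp (p z) * F z + exp (q z) * F z"
          by (simp add: distrib_right flip: mult.assoc)
        show ?thesis unfolding X using DF_Suc[of z] DF'[of z] by algebra
      qed
      \<comment> \<open>Multiplying by e^(-P) turns e^p F back into \<open>F\<close>, so
        \<open>diff_y\<close> is the equation \<open>DF\<close>.\<close>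
      have "(\<lambda>z. exp (poly (- P) z) * (exp (p z) * F z)) = F"
        by (simp add: P flip: mult.assoc exp_add)
      then show "(fwd_diff c ^^ n) (\<lambda>z. exp (poly (- P) z) * (exp (p z) * F z)) z = exp (p z) * F z + b z" for z
        using DF by simp
    qed (use assms(1,9) \<open>d \<noteq> 0\<close> lead bper w0 in \<open>auto simp: d_def\<close>)
    then show False by (rule difference_system.inconsistent)
  qed
  then have "degree P = 0" "degree Q = 0" by (auto simp: d_def)
  then obtain u v where uv: "P = [:u:]" "Q = [:v:]" by (meson degree_eq_zeroE)
  have "exp u = 1" "exp v = 1"
    using constant_multipliers_eq_1[of n "exp u" "exp v" c b w0 F w1] assms(1,11) w0 DF DF' w1 diffF[OF assms(1)]
    by (auto simp: P Q uv simp del: funpow.simps)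
  \<comment> \<open>With both multipliers equal to 1, \<open>DF_Suc\<close> gives \<Delta> F and
    \<open>DF'\<close> gives F + b for the same difference.\<close>
  then have "F (z + c) - F z = F z + b z" for z
    using DF_Suc[of z] DF'[of z] by (simp add: P Q uv)
  then show ?thesis by (simp add: F_def fwd_diff_def aper algebra_simps)
qed

end
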